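(* Let $F$ be a fixed finite set of denial constraints. Consider the following nondeterministic algorithm, taking as input an instance $I$ and a priority $\succ$ of $I$ w.r.t. $F$: initialize $I^o:=I$ and $J:=\varnothing$; while $\omega_\succ(I^o)\neq\varnothing$, choose (nondeterministically) a fact $x\in\omega_\succ(I^o)$, set $I^o:=I^o\setminus\{x\}$, and if $J\cup\{x\}$ is consistent with $F$ set $J:=J\cup\{x\}$; finally return $J$. This algorithm is a sound and complete algorithm constructing completion-optimal repairs: every run returns a repair of $I$ w.r.t. $F$ that is completion optimal w.r.t. $\succ$ and $F$, and every such completion-optimal repair is returned by some run. Moreover it works in time polynomial in the size of $I$ and $\succ$.
   Context: A database schema is a set of relation names of fixed positive arity; each attribute ranges over one of two disjoint infinite domains: the rationals $\mathbb{Q}$ (with built-in predicates $=,\neq,<,\le,>,\ge$) or a set $D$ of uninterpreted constants (with built-in predicates $=,\neq$). A fact is an expression $R(t)$ with $R$ a relation name and $t$ a tuple of constants of the right arity and types. A database instance is a finite set of facts. A denial constraint is a sentence $\forall\bar x.\ \neg[R_1(\bar x_1)\wedge\dots\wedge R_n(\bar x_n)\wedge\varphi(\bar x)]$ with $n>0$, $\bar x_1\cup\dots\cup\bar x_n=\bar x$, and $\varphi$ a quantifier-free formula using only built-in predicates. A set of facts $\{R_1(t_1),\dots,R_n(t_n)\}\subseteq I$ is a conflict in $I$ w.r.t. $F$ if for some denial constraint $\forall\bar x.\ \neg[R_1(\bar x_1)\wedge\dots\wedge R_n(\bar x_n)\wedge\varphi(\bar x)]$ in $F$ there is a substitution $\rho$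 of constants for $\bar x$ such that $\varphi(\rho(\bar x))$ is true and $\rho(\bar x_i)=t_i$ for all $i$; an instance is consistent with $F$ iff it satisfies $F$, i.e. iff it contains no conflict. A repair of $I$ w.r.t. $F$ is a maximal (under inclusion) subset of $I$ consistent with $F$. Two facts of $I$ are neighbors if some conflict contains both. A priority of $I$ w.r.t. $F$ is an acyclic binary relation $\succ$ on $I$ such that $x\succ y$ implies that $x$ and $y$ are neighbors. A priority is total if no different priority of $I$ w.r.t. $F$ contains it. A set $I'\subseteq I$ is globally optimal w.r.t. $\succ$ and $F$ if there are no nonempty $X\subseteq I'$ and $Y\subseteq I\setminus I'$ such that $\forall x\in X.\ \exists y\in Y.\ y\succ x$ and $(I'\setminus X)\cup Y$ is consistent with $F$. $I'$ is completion optimal w.r.t. $\succ$ and $F$ if there is a total priority $\succ'\supseteq\succ$ such that $I'$ is globally optimal w.r.t. $\succ'$ and $F$. The winnow operator is $\omega_\succ(K)=\{x\in K : \nexists y\in K.\ y\succ x\}$ for $K\subseteq I$. Complexity is data complexity: $F$ is fixed. *)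

theory Defs
  imports Complex_Main "HOL-Library.Log_Nat" "HOL-Computational_Algebra.Polynomial"
begin

section \<open>Schemas, facts, instances\<close>

datatype 'd dconst = Num rat | Name 'd

datatype sort = QSort | DSort

fun sort_of :: "'d dconst \<Rightarrow> sort" where
  "sort_of (Num q) = QSort"
| "sort_of (Name d) = DSort"

type_synonym 'r schema = "'r \<Rightarrow> sort list option"
type_synonym ('r, 'd) fact = "'r \<times> 'd dconst list"

definition wf_schema :: "'r schema \<Rightarrow> bool" where
  "wf_schema S \<longleftrightarrow> (\<forall>R. S R \<noteq> Some [])"

definition db_instance :: "'r schema \<Rightarrow> ('r, 'd) fact set \<Rightarrow> bool" where
  "db_instance S I \<longleftrightarrow> finite I \<and> (\<forall>(R, t) \<in> I. S R = Some (map sort_of t))"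

section \<open>Denial constraints\<close>

text \<open>The condition of a constraint may mention constants as well as variables.\<close>

datatype 'd trm = Var nat | Con "'d dconst"

datatype cmp = EQ | NEQ | LT | LE | GT | GE

datatype 'd qf =
    Cmp cmp "'d trm" "'d trm"
  | Neg "'d qf"
  | Conj "'d qf" "'d qf"
  | Disj "'d qf" "'d qf"

text \<open>\<open>Denial [(R\<^sub>1, x\<^sub>1), \<dots>, (R\<^sub>n, x\<^sub>n)] \<phi>\<close> stands for
  \<open>\<forall>x. \<not> (R\<^sub>1(x\<^sub>1) \<and> \<dots> \<and> R\<^sub>n(x\<^sub>n) \<and> \<phi>(x))\<close>.\<close>

datatype ('r, 'd) denial = Denial (body_atoms: "('r \<times> nat list) list") (condition: "'d qf")

fun trm_val :: "(nat \<Rightarrow> 'd dconst) \<Rightarrow> 'd trm \<Rightarrow> 'd dconst" where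
  "trm_val \<rho> (Var x) = \<rho> x"
| "trm_val \<rho> (Con c) = c"

fun num_rel :: "(rat \<Rightarrow> rat \<Rightarrow> bool) \<Rightarrow> 'd dconst \<Rightarrow> 'd dconst \<Rightarrow> bool" where
  "num_rel P (Num a) (Num b) = P a b"
| "num_rel P _ _ = False"

fun cmp_holds :: "cmp \<Rightarrow> 'd dconst \<Rightarrow> 'd dconst \<Rightarrow> bool" where
  "cmp_holds EQ a b = (a = b)"
| "cmp_holds NEQ a b = (a \<noteq> b)"
| "cmp_holds LT a b = num_rel (<) a b"
| "cmp_holds LE a b = num_rel (\<le>) a b"
| "cmp_holds GT a b = num_rel (>) a b"
| "cmp_holds GE a b = num_rel (\<ge>) a b"

fun holds :: "(nat \<Rightarrow> 'd dconst) \<Rightarrow> 'd qf \<Rightarrow> bool" where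
  "holds \<rho> (Cmp p a b) = cmp_holds p (trm_val \<rho> a) (trm_val \<rho> b)"
| "holds \<rho> (Neg f) = (\<not> holds \<rho> f)"
| "holds \<rho> (Conj f g) = (holds \<rho> f \<and> holds \<rho> g)"
| "holds \<rho> (Disj f g) = (holds \<rho> f \<or> holds \<rho> g)"

fun trm_sort :: "(nat \<Rightarrow> sort) \<Rightarrow> 'd trm \<Rightarrow> sort" where
  "trm_sort \<Gamma> (Var x) = \<Gamma> x"
| "trm_sort \<Gamma> (Con c) = sort_of c"

fun trm_vars :: "'d trm \<Rightarrow> nat set" where
  "trm_vars (Var x) = {x}"
| "trm_vars (Con c) = {}"

fun qf_vars :: "'d qf \<Rightarrow> nat set" where
  "qf_vars (Cmp p a b) = trm_vars a \<union> trm_vars b"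
| "qf_vars (Neg f) = qf_vars f"
| "qf_vars (Conj f g) = qf_vars f \<union> qf_vars g"
| "qf_vars (Disj f g) = qf_vars f \<union> qf_vars g"

text \<open>Only \<open>=\<close> and \<open>\<noteq>\<close> are available on the sort of uninterpreted constants.\<close>

fun wf_qf :: "(nat \<Rightarrow> sort) \<Rightarrow> 'd qf \<Rightarrow> bool" where
  "wf_qf \<Gamma> (Cmp p a b) \<longleftrightarrow>
     trm_sort \<Gamma> a = trm_sort \<Gamma> b \<and> (p \<in> {EQ, NEQ} \<or> trm_sort \<Gamma> a = QSort)"
| "wf_qf \<Gamma> (Neg f) \<longleftrightarrow> wf_qf \<Gamma> f"
| "wf_qf \<Gamma> (Conj f g) \<longleftrightarrow> wf_qf \<Gamma> f \<and> wf_qf \<Gamma> g"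
| "wf_qf \<Gamma> (Disj f g) \<longleftrightarrow> wf_qf \<Gamma> f \<and> wf_qf \<Gamma> g"

definition wf_denial :: "'r schema \<Rightarrow> ('r, 'd) denial \<Rightarrow> bool" where
  "wf_denial S dc \<longleftrightarrow>
     body_atoms dc \<noteq> [] \<and>
     qf_vars (condition dc) \<subseteq> (\<Union>(R, xs) \<in> set (body_atoms dc). set xs) \<and>
     (\<exists>\<Gamma>. (\<forall>(R, xs) \<in> set (body_atoms dc). S R = Some (map \<Gamma> xs)) \<and> wf_qf \<Gamma> (condition dc))"

text \<open>Substitutions are not required to respect sorts: every variable of a well-formed
  constraint occurs in some atom, and the facts of an instance are well-sorted.\<close>

definition subst_atom :: "(nat \<Rightarrow> 'd dconst) \<Rightarrow> 'r \<times> nat list \<Rightarrow> ('r, 'd) fact" where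
  "subst_atom \<rho> = (\<lambda>(R, xs). (R, map \<rho> xs))"

definition satisfies :: "('r, 'd) fact set \<Rightarrow> ('r, 'd) denial \<Rightarrow> bool" where
  "satisfies J dc \<longleftrightarrow>
     (\<forall>\<rho>. \<not> ((\<forall>a \<in> set (body_atoms dc). subst_atom \<rho> a \<in> J) \<and> holds \<rho> (condition dc)))"

definition consistent :: "('r, 'd) denial set \<Rightarrow> ('r, 'd) fact set \<Rightarrow> bool" where
  "consistent F J \<longleftrightarrow> (\<forall>dc \<in> F. satisfies J dc)"

definition conflict :: "('r, 'd) denial set \<Rightarrow> ('r, 'd) fact set \<Rightarrow> ('r, 'd) fact set \<Rightarrow> bool" where
  "conflict F I C \<longleftrightarrow> C \<subseteq> I \<and>
     (\<exists>dc \<in> F. \<exists>\<rho>. holds \<rho> (condition dc) \<and> C = subst_atom \<rho> ` set (body_atoms dc))"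

lemma consistent_iff_no_conflict: "consistent F J \<longleftrightarrow> (\<nexists>C. conflict F J C)"
  unfolding consistent_def satisfies_def conflict_def by blast

definition repair ::
    "('r, 'd) denial set \<Rightarrow> ('r, 'd) fact set \<Rightarrow> ('r, 'd) fact set \<Rightarrow> bool" where
  "repair F I J \<longleftrightarrow> J \<subseteq> I \<and> consistent F J \<and>
     (\<forall>K. K \<subseteq> I \<and> consistent F K \<and> J \<subseteq> K \<longrightarrow> K = J)"

definition neighbors ::
    "('r, 'd) denial set \<Rightarrow> ('r, 'd) fact set \<Rightarrow> ('r, 'd) fact \<Rightarrow> ('r, 'd) fact \<Rightarrow> bool" where
  "neighbors F I x y \<longleftrightarrow> (\<exists>C. conflict F I C \<and> x \<in> C \<and> y \<in> C)"

section \<open>Priorities and optimality\<close>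

text \<open>A pair \<open>(x, y)\<close> in a priority means that \<open>x\<close> is preferred to \<open>y\<close>.\<close>

type_synonym ('r, 'd) preference = "(('r, 'd) fact \<times> ('r, 'd) fact) set"

definition priority ::
    "('r, 'd) denial set \<Rightarrow> ('r, 'd) fact set \<Rightarrow> ('r, 'd) preference \<Rightarrow> bool" where
  "priority F I P \<longleftrightarrow> P \<subseteq> I \<times> I \<and> acyclic P \<and> (\<forall>(x, y) \<in> P. neighbors F I x y)"

definition total_priority ::
    "('r, 'd) denial set \<Rightarrow> ('r, 'd) fact set \<Rightarrow> ('r, 'd) preference \<Rightarrow> bool" where
  "total_priority F I P \<longleftrightarrow> priority F I P \<and> (\<forall>P'. priority F I P' \<and> P \<subseteq> P' \<longrightarrow> P' = P)"

definition globally_optimal ::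
    "('r, 'd) denial set \<Rightarrow> ('r, 'd) fact set \<Rightarrow> ('r, 'd) preference \<Rightarrow> ('r, 'd) fact set \<Rightarrow> bool"
  where
  "globally_optimal F I P J \<longleftrightarrow> J \<subseteq> I \<and>
     \<not> (\<exists>X Y. X \<noteq> {} \<and> X \<subseteq> J \<and> Y \<noteq> {} \<and> Y \<subseteq> I - J \<and>
              (\<forall>x \<in> X. \<exists>y \<in> Y. (y, x) \<in> P) \<and> consistent F ((J - X) \<union> Y))"

definition completion_optimal ::
    "('r, 'd) denial set \<Rightarrow> ('r, 'd) fact set \<Rightarrow> ('r, 'd) preference \<Rightarrow> ('r, 'd) fact set \<Rightarrow> bool"
  where
  "completion_optimal F I P J \<longleftrightarrow>
     (\<exists>P'. total_priority F I P' \<and> P \<subseteq> P' \<and> globally_optimal F I P' J)"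

section \<open>The nondeterministic algorithm\<close>

definition winnow :: "('r, 'd) preference \<Rightarrow> ('r, 'd) fact set \<Rightarrow> ('r, 'd) fact set" where
  "winnow P K = {x \<in> K. \<nexists>y. y \<in> K \<and> (y, x) \<in> P}"

text \<open>A state is a pair \<open>(I\<^sup>o, J)\<close>; one step is one iteration of the loop.\<close>

type_synonym ('r, 'd) state = "('r, 'd) fact set \<times> ('r, 'd) fact set"

inductive alg_step ::
    "('r, 'd) denial set \<Rightarrow> ('r, 'd) preference \<Rightarrow> ('r, 'd) state \<Rightarrow> ('r, 'd) state \<Rightarrow> bool"
  for F P where
  "x \<in> winnow P Io \<Longrightarrow>
   alg_step F P (Io, J) (Io - {x}, if consistent F (J \<union> {x}) then J \<union> {x} else J)"

definition alg_returns ::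
    "('r, 'd) denial set \<Rightarrow> ('r, 'd) fact set \<Rightarrow> ('r, 'd) preference \<Rightarrow> ('r, 'd) fact set \<Rightarrow> bool"
  where
  "alg_returns F I P J \<longleftrightarrow>
     (\<exists>Io. (alg_step F P)\<^sup>*\<^sup>* (I, {}) (Io, J) \<and> winnow P Io = {})"

section \<open>Machine model for running times\<close>

text \<open>Running times are measured for nondeterministic while-programs over binary trees, whose
  leaves are relation names and constants. Registers hold pointers to trees, so copying, pairing
  and projecting are unit-cost. Comparisons are charged: testing equality costs the total size of
  the operands, and comparing two rationals costs the square of that size, which pays for
  cross-multiplying numerators and denominators. Rationals are measured by bit length; relation
  names and uninterpreted constants are atomic symbols of size one. A program mentions
  only finitely many registers and literals.\<close>

datatype ('r, 'd) val =
    Leaf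
  | Rel 'r
  | Const "'d dconst"
  | Node "('r, 'd) val" "('r, 'd) val"

fun bits :: "int \<Rightarrow> nat" where
  "bits k = nat (bitlen \<bar>k\<bar>)"

fun dconst_size :: "'d dconst \<Rightarrow> nat" where
  "dconst_size (Num q) = 1 + bits (fst (quotient_of q)) + bits (snd (quotient_of q))"
| "dconst_size (Name d) = 1"

fun val_size :: "('r, 'd) val \<Rightarrow> nat" where
  "val_size Leaf = 1"
| "val_size (Rel R) = 1"
| "val_size (Const c) = dconst_size c"
| "val_size (Node u v) = 1 + val_size u + val_size v"

type_synonym ('r, 'd) store = "nat \<Rightarrow> ('r, 'd) val"

datatype test = IsNode nat | Same nat nat | Less nat nat

fun test_holds :: "test \<Rightarrow> ('r, 'd) store \<Rightarrow> bool" where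
  "test_holds (IsNode i) s = (case s i of Node u v \<Rightarrow> True | _ \<Rightarrow> False)"
| "test_holds (Same i j) s = (s i = s j)"
| "test_holds (Less i j) s =
     (case (s i, s j) of (Const a, Const b) \<Rightarrow> num_rel (<) a b | _ \<Rightarrow> False)"

fun test_cost :: "test \<Rightarrow> ('r, 'd) store \<Rightarrow> nat" where
  "test_cost (IsNode i) s = 1"
| "test_cost (Same i j) s = 1 + val_size (s i) + val_size (s j)"
| "test_cost (Less i j) s = 1 + (val_size (s i) + val_size (s j))\<^sup>2"

datatype ('r, 'd) com =
    SKIP
  | Load nat "('r, 'd) val"
  | Copy nat nat
  | MkNode nat nat nat
  | Left nat nat
  | Right nat nat
  | Seq "('r, 'd) com" "('r, 'd) com"
  | If test "('r, 'd) com" "('r, 'd) com"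
  | While test "('r, 'd) com"
  | Choice "('r, 'd) com" "('r, 'd) com"

fun left_of :: "('r, 'd) val \<Rightarrow> ('r, 'd) val" where
  "left_of (Node u v) = u"
| "left_of _ = Leaf"

fun right_of :: "('r, 'd) val \<Rightarrow> ('r, 'd) val" where
  "right_of (Node u v) = v"
| "right_of _ = Leaf"

type_synonym ('r, 'd) config = "('r, 'd) com \<times> ('r, 'd) store"

inductive mstep :: "('r, 'd) config \<Rightarrow> nat \<Rightarrow> ('r, 'd) config \<Rightarrow> bool" where
  Load: "mstep (Load i v, s) 1 (SKIP, s(i := v))"
| Copy: "mstep (Copy i j, s) 1 (SKIP, s(i := s j))"
| MkNode: "mstep (MkNode i j k, s) 1 (SKIP, s(i := Node (s j) (s k)))"
| Left: "mstep (Left i j, s) 1 (SKIP, s(i := left_of (s j)))"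
| Right: "mstep (Right i j, s) 1 (SKIP, s(i := right_of (s j)))"
| Seq_Skip: "mstep (Seq SKIP c, s) 1 (c, s)"
| Seq: "mstep (c\<^sub>1, s) t (c\<^sub>1', s') \<Longrightarrow> mstep (Seq c\<^sub>1 c\<^sub>2, s) t (Seq c\<^sub>1' c\<^sub>2, s')"
| If: "mstep (If b c\<^sub>1 c\<^sub>2, s) (test_cost b s) (if test_holds b s then c\<^sub>1 else c\<^sub>2, s)"
| While: "mstep (While b c, s) 1 (If b (Seq c (While b c)) SKIP, s)"
| Choice1: "mstep (Choice c\<^sub>1 c\<^sub>2, s) 1 (c\<^sub>1, s)"
| Choice2: "mstep (Choice c\<^sub>1 c\<^sub>2, s) 1 (c\<^sub>2, s)"

inductive msteps :: "('r, 'd) config \<Rightarrow> nat \<Rightarrow> ('r, 'd) config \<Rightarrow> bool" where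
  refl: "msteps cfg 0 cfg"
| step: "mstep cfg t cfg' \<Longrightarrow> msteps cfg' u cfg'' \<Longrightarrow> msteps cfg (t + u) cfg''"

text \<open>Every step costs at least one unit and only \<open>SKIP\<close> is halted, so a bound on the cost of
  all (partial) runs of a program implies that all its runs halt.\<close>

lemma mstep_cost_pos: "mstep cfg t cfg' \<Longrightarrow> 0 < t"
proof (induction rule: mstep.induct)
  case (If b c\<^sub>1 c\<^sub>2 s)
  show ?case by (cases b) simp_all
qed simp_all

lemma mstep_progress: "c \<noteq> SKIP \<Longrightarrow> \<exists>t cfg. mstep (c, s) t cfg"
proof (induction c)
  case (Seq c\<^sub>1 c\<^sub>2)
  show ?case
  proof (cases "c\<^sub>1 = SKIP")
    case True
    then show ?thesis by (blast intro: mstep.Seq_Skip)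
  next
    case False
    with Seq.IH(1) obtain t c' s' where "mstep (c\<^sub>1, s) t (c', s')" by auto
    then show ?thesis by (blast intro: mstep.Seq)
  qed
qed (blast intro: mstep.intros)+

definition exec :: "('r, 'd) com \<Rightarrow> ('r, 'd) store \<Rightarrow> ('r, 'd) store \<Rightarrow> bool" where
  "exec c s s' \<longleftrightarrow> (\<exists>t. msteps (c, s) t (SKIP, s'))"

section \<open>Polynomial-time implementations of the algorithm\<close>

fun list_val :: "('r, 'd) val list \<Rightarrow> ('r, 'd) val" where
  "list_val [] = Leaf"
| "list_val (v # vs) = Node v (list_val vs)"

fun fact_val :: "('r, 'd) fact \<Rightarrow> ('r, 'd) val" where
  "fact_val (R, t) = Node (Rel R) (list_val (map Const t))"

fun edge_val :: "('r, 'd) fact \<times> ('r, 'd) fact \<Rightarrow> ('r, 'd) val" where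
  "edge_val (x, y) = Node (fact_val x) (fact_val y)"

text \<open>A finite set is represented by a list of its elements, in any order.\<close>

definition encodes_set :: "('a \<Rightarrow> ('r, 'd) val) \<Rightarrow> 'a set \<Rightarrow> ('r, 'd) val \<Rightarrow> bool" where
  "encodes_set enc A v \<longleftrightarrow> (\<exists>xs. distinct xs \<and> set xs = A \<and> v = list_val (map enc xs))"

text \<open>The input consists of the instance in register 0 and the priority in register 1.\<close>

definition input_store ::
    "('r, 'd) fact set \<Rightarrow> ('r, 'd) preference \<Rightarrow> ('r, 'd) store \<Rightarrow> bool" where
  "input_store I P s \<longleftrightarrow>
     encodes_set fact_val I (s 0) \<and> encodes_set edge_val P (s 1) \<and> (\<forall>i \<ge> 2. s i = Leaf)"

definition input_size :: "('r, 'd) store \<Rightarrow> nat" where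
  "input_size s = val_size (s 0) + val_size (s 1)"

text \<open>During the run registers 0 to 3 hold \<open>I\<^sup>o\<close>, the priority, \<open>J\<close> and the result
  of applying the winnow operator to \<open>I\<^sup>o\<close>; the other registers are unconstrained.\<close>

fun represents ::
    "('r, 'd) preference \<Rightarrow> ('r, 'd) state \<Rightarrow> ('r, 'd) store \<Rightarrow> bool" where
  "represents P (Io, J) s \<longleftrightarrow>
     encodes_set fact_val Io (s 0) \<and> encodes_set edge_val P (s 1) \<and>
     encodes_set fact_val J (s 2) \<and> encodes_set fact_val (winnow P Io) (s 3)"

definition loop_program :: "('r, 'd) com \<Rightarrow> ('r, 'd) com \<Rightarrow> ('r, 'd) com" where
  "loop_program init body = Seq init (While (IsNode 3) body)"

text \<open>A program implements the algorithm if its initialization sets up the initial state,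
  its loop is controlled by non-emptiness of the winnow set, and the executions of its loop
  body are, in both directions, the possible iterations of the algorithm from each reachable
  state. Consequently its possible outputs, read off register 2, are the sets returned
  by the algorithm.\<close>

definition implements ::
    "('r, 'd) denial set \<Rightarrow> ('r, 'd) fact set \<Rightarrow> ('r, 'd) preference \<Rightarrow>
     ('r, 'd) com \<Rightarrow> ('r, 'd) com \<Rightarrow> bool" where
  "implements F I P init body \<longleftrightarrow>
     (\<forall>s s'. input_store I P s \<and> exec init s s' \<longrightarrow> represents P (I, {}) s') \<and>
     (\<forall>\<sigma> s. (alg_step F P)\<^sup>*\<^sup>* (I, {}) \<sigma> \<and> winnow P (fst \<sigma>) \<noteq> {} \<and> represents P \<sigma> s \<longrightarrow>
        (\<forall>s'. exec body s s' \<longrightarrow> (\<exists>\<sigma>'. alg_step F P \<sigma> \<sigma>' \<and> represents P \<sigma>' s')) \<and>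
        (\<forall>\<sigma>'. alg_step F P \<sigma> \<sigma>' \<longrightarrow> (\<exists>s'. exec body s s' \<and> represents P \<sigma>' s'))) \<and>
     (\<forall>s. input_store I P s \<longrightarrow>
        (\<forall>s'. exec (loop_program init body) s s' \<longrightarrow>
           (\<exists>J. alg_returns F I P J \<and> encodes_set fact_val J (s' 2))) \<and>
        (\<forall>J. alg_returns F I P J \<longrightarrow>
           (\<exists>s'. exec (loop_program init body) s s' \<and> encodes_set fact_val J (s' 2))))"

definition all_runs_within ::
    "nat poly \<Rightarrow> ('r, 'd) fact set \<Rightarrow> ('r, 'd) preference \<Rightarrow> ('r, 'd) com \<Rightarrow> bool" where
  "all_runs_within p I P c \<longleftrightarrow>
     (\<forall>s t cfg. input_store I P s \<and> msteps (c, s) t cfg \<longrightarrow> t \<le> poly p (input_size s))"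

end

theory Submission
  imports Defs
begin

text \<open>A run removes the facts of \<open>I\<close> in some order extending the priority and keeps a fact iff it
  is consistent with those kept before. Orienting all pairs of neighbors along this order gives a
  total priority, for which the greedily built set is globally optimal: in a potential improvement
  \<open>(X, Y)\<close> the first fact of \<open>Y\<close> was rejected because of kept facts that precede all
  of \<open>X\<close>. Conversely, for a total priority the greedy set of any run is the only globally
  optimal repair, since a repair \<open>J\<close> that differs from the greedy set \<open>J'\<close> is improved by
  exchanging \<open>J - J'\<close> for \<open>J' - J\<close>.

  For the running time, a conjunction of \<open>n\<close> atoms is tested by \<open>n\<close> nested loops over the
  facts, and \<open>n\<close> is constant because the constraints are fixed.\<close>

section \<open>Runs of the algorithm as greedy constructions\<close>

text \<open>Runs are replaced by rank functions because a single \<open>f\<close> can be read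
  against two priorities: ranks that respect a total extension also respect the smaller given
  priority. This is how a run for a completion becomes a run for the input. Conflicts may have more
  than two facts, so a rejected fact need not be blocked by one kept fact alone. The exchange is
  therefore made wholesale: the conflict that rejects a fact \<open>x\<close> of
  \<open>J - J'\<close> consists of \<open>x\<close> and earlier facts of \<open>J'\<close>; it
  cannot lie inside the consistent \<open>J\<close>, so it contains an earlier neighbor of
  \<open>x\<close> in \<open>J' - J\<close>. Totality orients that pair and the rank fixes the
  direction. On the machine side, soundness and cost speak of all outcomes, completeness of some
  outcome. The predicate \<open>runs\<close> carries the first kind and, by progress, yields some
  halting execution; particular executions are built by hand only for choosing a prescribed fact and
  for following a given run through the main loop.\<close>

text \<open>\<open>D\<close> is the set of facts already removed, so one predicate describes partial
  runs (\<open>D = I - Io\<close>) and complete ones (\<open>D = I\<close>). The clause on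
  \<open>P\<close> also makes \<open>D\<close> closed under passing to preferred facts.\<close>

definition greedy_rank ::
    "('r, 'd) denial set \<Rightarrow> ('r, 'd) preference \<Rightarrow> ('r, 'd) fact set \<Rightarrow> ('r, 'd) fact set \<Rightarrow>
     (('r, 'd) fact \<Rightarrow> nat) \<Rightarrow> bool" where
  "greedy_rank F P D J f \<longleftrightarrow> inj_on f D \<and> J \<subseteq> D \<and>
     (\<forall>(x, y) \<in> P. y \<in> D \<longrightarrow> x \<in> D \<and> f x < f y) \<and>
     (\<forall>x \<in> D. x \<in> J \<longleftrightarrow> consistent F (insert x {y \<in> J. f y < f x}))"

lemma consistent_mono: "consistent F B \<Longrightarrow> A \<subseteq> B \<Longrightarrow> consistent F A"
  unfolding consistent_def satisfies_def by blast

lemma conflict_mono: "conflict F A C \<Longrightarrow> A \<subseteq> B \<Longrightarrow> conflict F B C"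
  unfolding conflict_def by blast

lemma consistent_empty: "\<forall>dc \<in> F. body_atoms dc \<noteq> [] \<Longrightarrow> consistent F {}"
  unfolding consistent_def satisfies_def by (metis empty_iff hd_in_set)

text \<open>\<open>P\<close> restricted to \<open>K\<close> is finite and acyclic, hence
  well-founded, and a minimal element of \<open>K\<close> is undominated. Thus the loop stops only
  when no fact is left.\<close>

lemma winnow_nonempty:
  assumes "finite K" "K \<noteq> {}" "acyclic P"
  shows "winnow P K \<noteq> {}"
proof -
  let ?R = "{(y, x) \<in> P. y \<in> K \<and> x \<in> K}"
  have "finite ?R" using assms(1) by (rule_tac finite_subset[of _ "K \<times> K"]) auto
  moreover have "acyclic ?R" using assms(3) by (rule acyclic_subset) auto
  ultimately have "wf ?R" by (rule finite_acyclic_wf)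
  moreover obtain k where "k \<in> K" using assms(2) by blast
  ultimately obtain z where z: "z \<in> K" "\<And>y. (y, z) \<in> ?R \<Longrightarrow> y \<notin> K"
    by (erule_tac wfE_min) blast+
  then have "(y, z) \<notin> P" if "y \<in> K" for y using that by blast
  with z(1) have "z \<in> winnow P K" unfolding winnow_def by blast
  then show ?thesis by auto
qed

lemma alg_step_iff:
  "alg_step F P (Io, J) \<sigma> \<longleftrightarrow>
     (\<exists>x \<in> winnow P Io.
        \<sigma> = (Io - {x}, if consistent F (insert x J) then insert x J else J))"
  by (auto simp: alg_step.simps)

lemma alg_run_subset:
  assumes "(alg_step F P)\<^sup>*\<^sup>* (I, {}) \<sigma>"
  shows "fst \<sigma> \<subseteq> I \<and> snd \<sigma> \<subseteq> I - fst \<sigma>"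
  using assms
proof (induction rule: rtranclp_induct)
  case (step \<sigma> \<sigma>')
  then show ?case
    by (cases \<sigma>) (auto simp: alg_step_iff winnow_def split: if_splits)
qed auto

text \<open>Ranks record the order of removal. The strict bound \<open>n\<close> on the ranks used
  so far is carried along because it supplies the rank of the next fact.\<close>

lemma alg_run_greedy_rank:
  assumes "(alg_step F P)\<^sup>*\<^sup>* (I, {}) \<sigma>" "P \<subseteq> I \<times> I"
  shows "\<exists>f n. greedy_rank F P (I - fst \<sigma>) (snd \<sigma>) f \<and> (\<forall>x \<in> I - fst \<sigma>. f x < n)"
  using assms(1)
proof (induction rule: rtranclp_induct)
  case base
  then show ?case by (auto simp: greedy_rank_def)
next
  case (step \<sigma> \<sigma>')
  obtain Io J where \<sigma>: "\<sigma> = (Io, J)" by fastforce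
  let ?D = "I - Io"
  from step.IH obtain f n where f: "greedy_rank F P ?D J f" and n: "\<forall>x \<in> ?D. f x < n"
    using \<sigma> by auto
  from step.hyps(2) obtain x where x: "x \<in> winnow P Io"
    and \<sigma>': "\<sigma>' = (Io - {x}, if consistent F (insert x J) then insert x J else J)"
    unfolding \<sigma> alg_step_iff by auto
  let ?J = "if consistent F (insert x J) then insert x J else J"
  let ?f = "f(x := n)"
  have xI: "x \<in> I" and xIo: "x \<in> Io"
    using x alg_run_subset[OF step.hyps(1)] by (auto simp: \<sigma> winnow_def)
  have D: "I - (Io - {x}) = insert x ?D" using xI by auto
  have JD: "J \<subseteq> ?D" using f by (simp add: greedy_rank_def)
  have xD: "x \<notin> ?D" using xIo by auto
  have inj: "inj_on ?f (insert x ?D)"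
    using f n xD by (auto simp: greedy_rank_def inj_on_def)
  \<comment> \<open>A fact preferred to \<open>x\<close> is in \<open>I\<close> because
    \<open>P \<subseteq> I \<times> I\<close>, and is no longer in \<open>Io\<close> because
    \<open>x\<close> is undominated there; so it was removed earlier.\<close>
  have pref: "a \<in> insert x ?D \<and> ?f a < ?f b" if ab: "(a, b) \<in> P" "b \<in> insert x ?D" for a b
  proof (cases "b = x")
    case True
    then have "a \<in> ?D" using x ab assms(2) unfolding winnow_def by blast
    then show ?thesis using n True xD by auto
  next
    case False
    then have "a \<in> ?D" "f a < f b" using f ab by (auto simp: greedy_rank_def)
    then show ?thesis using False xD by auto
  qed
  have char: "a \<in> ?J \<longleftrightarrow> consistent F (insert a {y \<in> ?J. ?f y < ?f a})"
    if a: "a \<in> insert x ?D" for a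
  proof (cases "a = x")
    case True
    have "{y \<in> ?J. ?f y < ?f x} = J" using n JD xD by auto
    then show ?thesis using True JD xD by auto
  next
    case False
    then have aD: "a \<in> ?D" using a by auto
    \<comment> \<open>The new fact gets a rank above all others, so the earlier acceptance tests do
      not see it.\<close>
    have eq: "{y \<in> ?J. ?f y < ?f a} = {y \<in> J. f y < f a}"
    proof -
      have "f a < n" using n aD by blast
      then show ?thesis using xD JD False by auto
    qed
    have "a \<in> ?J \<longleftrightarrow> a \<in> J" using False by auto
    then show ?thesis using f aD unfolding eq greedy_rank_def by blast
  qed
  have "greedy_rank F P (insert x ?D) ?J ?f"
    unfolding greedy_rank_def
  proof (intro conjI)
    show "?J \<subseteq> insert x ?D" using JD by auto
    show "\<forall>(a, b) \<in> P. b \<in> insert x ?D \<longrightarrow> a \<in> insert x ?D \<and> ?f a < ?f b"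
      by (intro ballI case_prodI2 impI) (rule pref, simp_all only:)
    show "\<forall>a \<in> insert x ?D. a \<in> ?J \<longleftrightarrow> consistent F (insert a {y \<in> ?J. ?f y < ?f a})"
      using char by (intro ballI)
  qed (fact inj)
  moreover have "?f y < Suc n" if "y \<in> insert x ?D" for y
    using n that by (cases "y = x") (simp_all add: less_SucI del: split_paired_All)
  ultimately show ?case unfolding \<sigma>' fst_conv snd_conv D by blast
qed

text \<open>A rank function is replayed by removing facts in increasing rank. The statement starts
  from an arbitrary upper segment \<open>Io\<close> of the ranks, where exactly
  \<open>J - Io\<close> has been kept, so that induction on \<open>card Io\<close> goes
  through.\<close>

lemma greedy_rank_alg_run:
  assumes f: "greedy_rank F P I J f" and "finite I"
    and "Io \<subseteq> I" and "\<forall>x \<in> Io. \<forall>y \<in> I - Io. f y < f x"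
  shows "(alg_step F P)\<^sup>*\<^sup>* (Io, J - Io) ({}, J)"
  using assms(3,4)
proof (induction "card Io" arbitrary: Io)
  case 0
  then have "Io = {}" using assms(2) finite_subset by fastforce
  then show ?case by simp
next
  case (Suc k)
  have fin: "finite Io" using Suc.prems(1) assms(2) finite_subset by blast
  have "Io \<noteq> {}" using Suc.hyps(2) by auto
  then obtain x where x: "x \<in> Io" "\<forall>y \<in> Io. f x \<le> f y"
    using fin Min_in[of "f ` Io"] Min_le[of "f ` Io"] by fastforce
  have xI: "x \<in> I" using x Suc.prems(1) by auto
  have JI: "J \<subseteq> I" and inj: "inj_on f I" using f by (auto simp: greedy_rank_def)
  have lt: "f x < f y" if "y \<in> Io - {x}" for y
    using that x inj Suc.prems(1) xI
    by (metis Diff_iff inj_onD insertI1 le_neq_implies_less subsetD)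
  \<comment> \<open>Any fact preferred to \<open>x\<close> has a smaller rank, while
    \<open>x\<close> has the least rank in \<open>Io\<close>.\<close>
  have win: "x \<in> winnow P Io"
    using f x xI unfolding greedy_rank_def winnow_def by fastforce
  \<comment> \<open>This identifies the set in the rank-based test of \<open>x\<close> with the
    current second component of the state.\<close>
  have "{y \<in> J. f y < f x} = J - Io"
    using Suc.prems(2) x JI by (auto simp: not_less dest: leD)
  then have "x \<in> J \<longleftrightarrow> consistent F (insert x (J - Io))"
    using f xI by (auto simp: greedy_rank_def)
  then have "J - (Io - {x}) =
      (if consistent F (insert x (J - Io)) then insert x (J - Io) else J - Io)"
    using x by auto
  then have "alg_step F P (Io, J - Io) (Io - {x}, J - (Io - {x}))"
    using win unfolding alg_step_iff by auto
  moreover have "(alg_step F P)\<^sup>*\<^sup>* (Io - {x}, J - (Io - {x})) ({}, J)"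
  proof (rule Suc.hyps(1))
    show "k = card (Io - {x})" using Suc.hyps(2) x fin by simp
    show "Io - {x} \<subseteq> I" using Suc.prems(1) by auto
    show "\<forall>z \<in> Io - {x}. \<forall>y \<in> I - (Io - {x}). f y < f z"
      using Suc.prems(2) lt by auto
  qed
  ultimately show ?case by (rule converse_rtranclp_into_rtranclp)
qed

lemma alg_returns_iff_greedy_rank:
  assumes "finite I" "P \<subseteq> I \<times> I" "acyclic P"
  shows "alg_returns F I P J \<longleftrightarrow> (\<exists>f. greedy_rank F P I J f)"
proof
  assume "alg_returns F I P J"
  then obtain Io where run: "(alg_step F P)\<^sup>*\<^sup>* (I, {}) (Io, J)" and w: "winnow P Io = {}"
    unfolding alg_returns_def by auto
  have "finite Io" using alg_run_subset[OF run] assms(1) finite_subset by auto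
  then have "Io = {}" using winnow_nonempty[OF _ _ assms(3)] w by blast
  then show "\<exists>f. greedy_rank F P I J f" using alg_run_greedy_rank[OF run assms(2)] by auto
next
  assume "\<exists>f. greedy_rank F P I J f"
  then obtain f where f: "greedy_rank F P I J f" by auto
  have "J - I = {}" using f by (auto simp: greedy_rank_def)
  then have "(alg_step F P)\<^sup>*\<^sup>* (I, {}) ({}, J)"
    using greedy_rank_alg_run[OF f assms(1) order_refl] unfolding \<open>J - I = {}\<close> by blast
  then show "alg_returns F I P J" unfolding alg_returns_def winnow_def by blast
qed

section \<open>Termination and existence of runs\<close>

lemma alg_step_card:
  assumes "alg_step F P \<sigma> \<sigma>'" "finite (fst \<sigma>)"
  shows "finite (fst \<sigma>') \<and> card (fst \<sigma>') < card (fst \<sigma>)"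
  using assms by (cases \<sigma>) (auto simp: alg_step_iff winnow_def simp del: card_Diff_insert intro!: card_Diff1_less)

lemma alg_terminates:
  assumes "finite I"
  shows "\<nexists>run. run 0 = (I, J) \<and> (\<forall>n. alg_step F P (run n) (run (Suc n)))"
proof
  assume "\<exists>run. run 0 = (I, J) \<and> (\<forall>n. alg_step F P (run n) (run (Suc n)))"
  then obtain run where r: "run 0 = (I, J)" "\<And>n. alg_step F P (run n) (run (Suc n))" by blast
  have fin: "finite (fst (run n))" for n
  proof (induction n)
    case (Suc n)
    then show ?case using alg_step_card r(2) by blast
  qed (simp add: r assms)
  have "card (fst (run n)) + n \<le> card I" for n
  proof (induction n)
    case (Suc n)
    then show ?case using alg_step_card[OF r(2)[of n] fin] by simp
  qed (simp add: r)
  from this[of "Suc (card I)"] show False by simp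
qed

text \<open>Used for a total extension of the priority, to obtain a greedy set with which a given
  optimal repair can be compared.\<close>

lemma alg_returns_exists:
  assumes "finite I"
  shows "\<exists>J. alg_returns F I P J"
proof -
  have "\<exists>Io' J'. (alg_step F P)\<^sup>*\<^sup>* (Io, J) (Io', J') \<and> winnow P Io' = {}"
    if "finite Io" for Io J
    using that
  proof (induction "card Io" arbitrary: Io J rule: less_induct)
    case less
    show ?case
    proof (cases "winnow P Io = {}")
      case False
      then obtain \<sigma>' where st: "alg_step F P (Io, J) \<sigma>'" by (auto simp: alg_step_iff)
      have "\<exists>Io' J'. (alg_step F P)\<^sup>*\<^sup>* (fst \<sigma>', snd \<sigma>') (Io', J') \<and> winnow P Io' = {}"
        by (rule less.hyps) (use alg_step_card[OF st] less.prems in auto)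
      then show ?thesis using st by (auto intro: converse_rtranclp_into_rtranclp)
    qed auto
  qed
  then show ?thesis using assms unfolding alg_returns_def by blast
qed

section \<open>Greedy sets are repairs\<close>

text \<open>The kept fact of highest rank was tested together with all other kept facts, so its
  acceptance certifies the whole of \<open>J\<close>. An empty \<open>J\<close> has no such fact and
  relies on \<open>consistent F {}\<close>.\<close>

lemma greedy_rank_consistent:
  assumes f: "greedy_rank F P I J f" and "finite I" "consistent F {}"
  shows "consistent F J"
proof (cases "J = {}")
  case False
  have J: "J \<subseteq> I" "finite J" using f assms(2) finite_subset by (auto simp: greedy_rank_def)
  obtain x where x: "x \<in> J" "\<forall>y \<in> J. f y \<le> f x"
    using J(2) False Max_in[of "f ` J"] Max_ge[of "f ` J"] by fastforce
  have "J \<subseteq> insert x {y \<in> J. f y < f x}"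
  proof
    fix y assume y: "y \<in> J"
    then have "f y < f x \<or> y = x"
      using x J f by (metis greedy_rank_def inj_onD le_neq_implies_less subsetD)
    then show "y \<in> insert x {y \<in> J. f y < f x}" using y by auto
  qed
  moreover have "consistent F (insert x {y \<in> J. f y < f x})"
    using f x J by (auto simp: greedy_rank_def)
  ultimately show ?thesis by (rule consistent_mono[rotated])
qed (use assms in simp)

text \<open>For maximality: a fact of a consistent superset \<open>K\<close> of \<open>J\<close> was
  tested only against a part of \<open>J\<close>, so by monotonicity its test succeeded.\<close>

lemma greedy_rank_repair:
  assumes f: "greedy_rank F P I J f" and "finite I" "consistent F {}"
  shows "repair F I J"
  unfolding repair_def
proof (intro conjI allI impI)
  show "J \<subseteq> I" using f by (simp add: greedy_rank_def)
  show "consistent F J" using greedy_rank_consistent[OF assms] .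
  fix K assume K: "K \<subseteq> I \<and> consistent F K \<and> J \<subseteq> K"
  show "K = J"
  proof
    show "K \<subseteq> J"
    proof
      fix x assume x: "x \<in> K"
      then have "insert x {y \<in> J. f y < f x} \<subseteq> K" using K by auto
      then have "consistent F (insert x {y \<in> J. f y < f x})" using K consistent_mono by blast
      then show "x \<in> J" using f x K by (auto simp: greedy_rank_def)
    qed
  qed (use K in simp)
qed

section \<open>Total priorities\<close>

lemma neighbors_sym: "neighbors F I x y \<longleftrightarrow> neighbors F I y x"
  unfolding neighbors_def by blast

lemma neighbors_in: "neighbors F I x y \<Longrightarrow> x \<in> I \<and> y \<in> I"
  unfolding neighbors_def conflict_def by blast

lemma acyclic_rank: "acyclic {(x, y). f x < (f y :: nat)}"
proof -
  have "{(x, y). f x < f y} = inv_image less_than f" by (auto simp: inv_image_def)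
  then show ?thesis by (simp add: wf_acyclic)
qed

text \<open>Injectivity of \<open>f\<close> gives every pair of distinct neighbors a direction. A
  pair of a larger priority is thus already present, or it is a loop, or it reverses a present pair
  and closes a cycle of length two.\<close>

lemma total_priority_of_rank:
  assumes "inj_on f I"
  shows "total_priority F I {(x, y). neighbors F I x y \<and> f x < (f y :: nat)}"
    (is "total_priority F I ?R")
proof -
  have "acyclic ?R" by (rule acyclic_subset[OF acyclic_rank]) auto
  then have pr: "priority F I ?R" unfolding priority_def by (auto dest: neighbors_in)
  have "P' = ?R" if P': "priority F I P'" "?R \<subseteq> P'" for P'
  proof
    show "P' \<subseteq> ?R"
    proof clarify
      fix R t R' t' assume p: "((R, t), (R', t')) \<in> P'"
      let ?x = "(R, t)" and ?y = "(R', t')"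
      have n: "neighbors F I ?x ?y" and ac: "acyclic P'" using P' p by (auto simp: priority_def)
      have "(?y, ?x) \<notin> P'"
        using ac p by (meson acyclic_def trancl.r_into_trancl trancl_into_trancl)
      then have "(?y, ?x) \<notin> ?R" using P'(2) by blast
      then have "f ?x \<le> f ?y" using n neighbors_sym by fastforce
      moreover have "f ?x \<noteq> f ?y"
      proof
        assume "f ?x = f ?y"
        then have "?x = ?y" using assms neighbors_in[OF n] by (metis inj_onD)
        then show False using ac p by (auto simp: acyclic_def)
      qed
      ultimately show "neighbors F I ?x ?y \<and> f ?x < f ?y" using n by simp
    qed
  qed (fact P'(2))
  then show ?thesis using pr unfolding total_priority_def by blast
qed

text \<open>By maximality a pair of neighbors is missing only if adding it would close a cycle. If
  both directions are missing, the two paths responsible form a cycle inside \<open>P\<close>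
  itself.\<close>

lemma total_priority_compares:
  assumes P: "total_priority F I P" and n: "neighbors F I x y" and "x \<noteq> y"
  shows "(x, y) \<in> P \<or> (y, x) \<in> P"
proof (rule ccontr)
  assume no: "\<not> ?thesis"
  have pr: "priority F I P" using P by (simp add: total_priority_def)
  have path: "(b, a) \<in> P\<^sup>*" if "neighbors F I a b" "(a, b) \<notin> P" for a b
  proof (rule ccontr)
    assume "(b, a) \<notin> P\<^sup>*"
    then have "priority F I (insert (a, b) P)"
      using pr that neighbors_in[OF that(1)] by (auto simp: priority_def)
    then show False using P that unfolding total_priority_def by blast
  qed
  have "(y, x) \<in> P\<^sup>*" "(x, y) \<in> P\<^sup>*"
    using path[of x y] path[of y x] n no neighbors_sym by blast+
  then have "(x, x) \<in> P\<^sup>+" using \<open>x \<noteq> y\<close> by (metis rtranclD trancl_trans)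
  then show False using pr unfolding priority_def acyclic_def by blast
qed

section \<open>Global optimality and completions\<close>

lemma greedy_rank_globally_optimal:
  assumes f: "greedy_rank F P I J f"
    and R: "\<forall>(x, y) \<in> R. f x < f y"
  shows "globally_optimal F I R J"
  unfolding globally_optimal_def
proof (intro conjI notI)
  show "J \<subseteq> I" using f by (simp add: greedy_rank_def)
  assume "\<exists>X Y. X \<noteq> {} \<and> X \<subseteq> J \<and> Y \<noteq> {} \<and> Y \<subseteq> I - J \<and>
    (\<forall>x \<in> X. \<exists>y \<in> Y. (y, x) \<in> R) \<and> consistent F ((J - X) \<union> Y)"
  then obtain X Y where Y: "Y \<noteq> {}" "Y \<subseteq> I - J"
    and dom: "\<forall>x \<in> X. \<exists>y \<in> Y. (y, x) \<in> R" and con: "consistent F ((J - X) \<union> Y)" by blast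
  obtain y where y: "y \<in> Y" "\<forall>z \<in> Y. f y \<le> f z"
    using Y(1) ex_has_least_nat[of "\<lambda>y. y \<in> Y" _ f] by blast
  \<comment> \<open>If such a \<open>z\<close> were in \<open>X\<close>, it would be dominated by a
    member of \<open>Y\<close> whose rank is below \<open>f z\<close> and hence below
    \<open>f y\<close>, against the choice of \<open>y\<close>.\<close>
  have "{z \<in> J. f z < f y} \<subseteq> J - X"
  proof
    fix z assume z: "z \<in> {z \<in> J. f z < f y}"
    have "z \<notin> X"
    proof
      assume "z \<in> X"
      then obtain y' where "y' \<in> Y" "f y' < f z" using dom R by blast
      then show False using y z by (metis (no_types, lifting) leD mem_Collect_eq order.strict_trans)
    qed
    then show "z \<in> J - X" using z by auto
  qed
  \<comment> \<open>The test that rejected \<open>y\<close> would therefore have succeeded.\<close>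
  then have "consistent F (insert y {z \<in> J. f z < f y})"
    by (intro consistent_mono[OF con]) (use y in auto)
  then show False using f y Y by (auto simp: greedy_rank_def)
qed

lemma greedy_rank_completion_optimal:
  assumes f: "greedy_rank F P I J f" and P: "priority F I P"
  shows "completion_optimal F I P J"
proof -
  let ?R = "{(x, y). neighbors F I x y \<and> f x < f y}"
  have "inj_on f I" using f by (simp add: greedy_rank_def)
  moreover have "P \<subseteq> ?R" using f P unfolding greedy_rank_def priority_def by fastforce
  moreover have "globally_optimal F I ?R J" by (rule greedy_rank_globally_optimal[OF f]) auto
  ultimately show ?thesis unfolding completion_optimal_def using total_priority_of_rank by blast
qed

lemma globally_optimal_eq_greedy:
  assumes rep: "repair F I J" and opt: "globally_optimal F I R J" and R: "total_priority F I R"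
    and f: "greedy_rank F R I J' f" and rep': "repair F I J'"
  shows "J = J'"
proof (rule ccontr)
  assume ne: "J \<noteq> J'"
  \<comment> \<open>Distinct maximal consistent sets are incomparable, so both sides of the exchange
    are nonempty.\<close>
  have "\<not> J \<subseteq> J'" "\<not> J' \<subseteq> J" using rep rep' ne unfolding repair_def by blast+
  moreover have "\<exists>y \<in> J' - J. (y, x) \<in> R" if x: "x \<in> J - J'" for x
  proof -
    have xI: "x \<in> I" using x rep by (auto simp: repair_def)
    have "\<not> consistent F (insert x {y \<in> J'. f y < f x})"
      using f x xI by (auto simp: greedy_rank_def)
    then obtain C where C: "conflict F (insert x {y \<in> J'. f y < f x}) C"
      unfolding consistent_iff_no_conflict by blast
    then have CI: "conflict F I C"
      by (rule conflict_mono) (use xI rep' in \<open>auto simp: repair_def\<close>)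
    \<comment> \<open>No consistent set contains a conflict. That \<open>C\<close> is not inside
      \<open>J\<close> yields a fact \<open>y\<close> missing from \<open>J\<close>; that
      \<open>C\<close> is not inside \<open>J'\<close> forces \<open>x\<close> into
      \<open>C\<close>, which makes the two facts neighbors.\<close>
    have "\<not> C \<subseteq> K" if "consistent F K" for K
      using that C unfolding consistent_iff_no_conflict conflict_def by blast
    then have "\<not> C \<subseteq> J" "\<not> C \<subseteq> J'" using rep rep' by (simp_all add: repair_def)
    moreover have "C \<subseteq> insert x {y \<in> J'. f y < f x}" using C by (simp add: conflict_def)
    ultimately obtain y where y: "x \<in> C" "y \<in> C" "y \<in> J'" "y \<notin> J" "f y < f x"
      using x by blast
    have "neighbors F I y x" using CI y unfolding neighbors_def by blast
    then have "(y, x) \<in> R \<or> (x, y) \<in> R" by (rule total_priority_compares[OF R]) (use x y in auto)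
    moreover have "(x, y) \<notin> R"
      using f y rep' unfolding greedy_rank_def repair_def by fastforce
    ultimately show ?thesis using y by blast
  qed
  moreover have "consistent F ((J - (J - J')) \<union> (J' - J))"
    by (rule consistent_mono[of _ J']) (use rep' in \<open>auto simp: repair_def\<close>)
  moreover have "J' - J \<subseteq> I - J" using rep' by (auto simp: repair_def)
  moreover have "J - J' \<noteq> {}" "J' - J \<noteq> {}" "J - J' \<subseteq> J" using calculation by auto
  ultimately have "\<exists>X Y. X \<noteq> {} \<and> X \<subseteq> J \<and> Y \<noteq> {} \<and> Y \<subseteq> I - J \<and>
      (\<forall>x \<in> X. \<exists>y \<in> Y. (y, x) \<in> R) \<and> consistent F ((J - X) \<union> Y)"
    by (intro exI[of _ "J - J'"] exI[of _ "J' - J"]) simp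
  then show False using opt unfolding globally_optimal_def by blast
qed

lemma alg_returns_iff_completion_optimal:
  assumes "finite I" "priority F I P" "consistent F {}"
  shows "alg_returns F I P J \<longleftrightarrow> repair F I J \<and> completion_optimal F I P J"
proof -
  have greedy: "alg_returns F I R K \<longleftrightarrow> (\<exists>f. greedy_rank F R I K f)" if "priority F I R" for R K
    using alg_returns_iff_greedy_rank[OF assms(1)] that by (simp add: priority_def)
  show ?thesis
  proof
    assume "alg_returns F I P J"
    then obtain f where "greedy_rank F P I J f" using greedy assms(2) by auto
    then show "repair F I J \<and> completion_optimal F I P J"
      using greedy_rank_repair greedy_rank_completion_optimal assms by blast
  next
    assume J: "repair F I J \<and> completion_optimal F I P J"
    then obtain R where R: "total_priority F I R" "P \<subseteq> R" "globally_optimal F I R J"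
      unfolding completion_optimal_def by auto
    have pr: "priority F I R" using R by (simp add: total_priority_def)
    obtain J' where "alg_returns F I R J'" using alg_returns_exists[OF assms(1)] by blast
    then obtain f where f: "greedy_rank F R I J' f" using greedy[OF pr] by auto
    have "J = J'"
      using globally_optimal_eq_greedy[OF _ R(3,1) f greedy_rank_repair[OF f assms(1,3)]] J by blast
    \<comment> \<open>The greedy set was obtained for the completion \<open>R\<close>. Only the
      order clause mentions the priority, and it weakens when \<open>R\<close> is replaced by its
      subset \<open>P\<close>.\<close>
    moreover have "greedy_rank F P I J' f" using f R(2) unfolding greedy_rank_def by blast
    ultimately show "alg_returns F I P J" using greedy[OF assms(2)] by blast
  qed
qed

section \<open>Cost-bounded total correctness\<close>

text \<open>Unfinished runs are bounded too. Since every step costs at least one unit,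
  \<open>T\<close> thereby enforces termination, and the predicate expresses total correctness for
  every resolution of the choices.\<close>

definition runs ::
    "('r, 'd) com \<Rightarrow> ('r, 'd) store \<Rightarrow> nat \<Rightarrow> (('r, 'd) store \<Rightarrow> bool) \<Rightarrow> bool" where
  "runs c s T Q \<longleftrightarrow>
     (\<forall>t c' s'. msteps (c, s) t (c', s') \<longrightarrow> t \<le> T \<and> (c' = SKIP \<longrightarrow> Q s'))"

inductive_cases mstep_SkipE: "mstep (SKIP, s) t cfg"
inductive_cases mstep_LoadE: "mstep (Load i v, s) t cfg"
inductive_cases mstep_CopyE: "mstep (Copy i j, s) t cfg"
inductive_cases mstep_MkNodeE: "mstep (MkNode i j k, s) t cfg"
inductive_cases mstep_LeftE: "mstep (Left i j, s) t cfg"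
inductive_cases mstep_RightE: "mstep (Right i j, s) t cfg"
inductive_cases mstep_SeqE: "mstep (Seq c1 c2, s) t cfg"
lemmas mstep_Seq_cases = mstep_SeqE[consumes 1, case_names skip step]
inductive_cases mstep_IfE: "mstep (If b c1 c2, s) t cfg"
inductive_cases mstep_WhileE: "mstep (While b c, s) t cfg"
inductive_cases mstep_ChoiceE: "mstep (Choice c1 c2, s) t cfg"

lemma runs_conseq:
  assumes "runs c s T Q" "\<And>s'. Q s' \<Longrightarrow> Q' s'" "T \<le> T'"
  shows "runs c s T' Q'"
  unfolding runs_def
proof (intro allI impI)
  fix t c' s' assume "msteps (c, s) t (c', s')"
  then have "t \<le> T \<and> (c' = SKIP \<longrightarrow> Q s')" using assms(1) unfolding runs_def by blast
  then show "t \<le> T' \<and> (c' = SKIP \<longrightarrow> Q' s')" using assms(2,3) by auto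
qed

lemma runs_mono: "runs c s T Q \<Longrightarrow> T \<le> T' \<Longrightarrow> runs c s T' Q"
  by (rule runs_conseq)

lemma runs_step:
  assumes "c \<noteq> SKIP"
    and "\<And>t c' s'. mstep (c, s) t (c', s') \<Longrightarrow> t \<le> T \<and> runs c' s' (T - t) Q"
  shows "runs c s T Q"
  unfolding runs_def
proof (intro allI impI)
  fix t c' s' assume "msteps (c, s) t (c', s')"
  then show "t \<le> T \<and> (c' = SKIP \<longrightarrow> Q s')"
  proof (cases rule: msteps.cases)
    case refl
    then show ?thesis using assms(1) by auto
  next
    case (step t1 cfg u)
    obtain c1 s1 where cfg: "cfg = (c1, s1)" by fastforce
    from assms(2) step(2) have t1: "t1 \<le> T" "runs c1 s1 (T - t1) Q" by (auto simp: cfg)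
    then have "u \<le> T - t1 \<and> (c' = SKIP \<longrightarrow> Q s')"
      using step(3) unfolding runs_def cfg by blast
    then show ?thesis using t1(1) step(1) by auto
  qed
qed

lemma runs_afterstep:
  assumes "runs c s T Q" "mstep (c, s) t (c', s')"
  shows "t \<le> T \<and> runs c' s' (T - t) Q"
proof -
  have "t + u \<le> T \<and> (c'' = SKIP \<longrightarrow> Q s'')" if "msteps (c', s') u (c'', s'')" for u c'' s''
    using msteps.step[OF assms(2) that] assms(1) by (auto simp: runs_def)
  then show ?thesis
    unfolding runs_def by (metis add_leD1 le_diff_conv2 add.commute msteps.refl)
qed

lemma runs_Skip: "Q s \<Longrightarrow> runs SKIP s 0 Q"
  by (auto simp: runs_def elim!: mstep_SkipE elim: msteps.cases)

lemma runs_SkipD: "runs SKIP s T Q \<Longrightarrow> Q s"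
  unfolding runs_def by (blast intro: msteps.refl)

lemma runs_Load: "Q (s(i := v)) \<Longrightarrow> runs (Load i v) s 1 Q"
  by (rule runs_step) (auto elim!: mstep_LoadE intro: runs_Skip)

lemma runs_Copy: "Q (s(i := s j)) \<Longrightarrow> runs (Copy i j) s 1 Q"
  by (rule runs_step) (auto elim!: mstep_CopyE intro: runs_Skip)

lemma runs_MkNode: "Q (s(i := Node (s j) (s k))) \<Longrightarrow> runs (MkNode i j k) s 1 Q"
  by (rule runs_step) (auto elim!: mstep_MkNodeE intro: runs_Skip)

lemma runs_Left: "Q (s(i := left_of (s j))) \<Longrightarrow> runs (Left i j) s 1 Q"
  by (rule runs_step) (auto elim!: mstep_LeftE intro: runs_Skip)

lemma runs_Right: "Q (s(i := right_of (s j))) \<Longrightarrow> runs (Right i j) s 1 Q"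
  by (rule runs_step) (auto elim!: mstep_RightE intro: runs_Skip)

text \<open>Induction on the budget of the first command, which drops with each step because costs
  are positive; the extra unit pays for discarding the finished \<open>SKIP\<close>. Nesting
  \<open>runs\<close> in the postcondition lets the rule chain like a weakest precondition.\<close>

lemma runs_Seq:
  assumes "runs c\<^sub>1 s T\<^sub>1 (\<lambda>s'. runs c\<^sub>2 s' T\<^sub>2 Q)"
  shows "runs (Seq c\<^sub>1 c\<^sub>2) s (T\<^sub>1 + 1 + T\<^sub>2) Q"
  using assms
proof (induction T\<^sub>1 arbitrary: c\<^sub>1 s rule: less_induct)
  case (less T)
  show ?case
  proof (rule runs_step, simp)
    fix t c' s' assume "mstep (Seq c\<^sub>1 c\<^sub>2, s) t (c', s')"
    then show "t \<le> T + 1 + T\<^sub>2 \<and> runs c' s' (T + 1 + T\<^sub>2 - t) Q"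
    proof (cases rule: mstep_Seq_cases)
      case skip
      then have "runs SKIP s T (\<lambda>s'. runs c\<^sub>2 s' T\<^sub>2 Q)" using less.prems by simp
      then have "runs c\<^sub>2 s T\<^sub>2 Q" by (rule runs_SkipD)
      then show ?thesis using skip by (auto intro: runs_mono)
    next
      case (step c1' s1)
      have t: "t \<le> T" "runs c1' s1 (T - t) (\<lambda>s'. runs c\<^sub>2 s' T\<^sub>2 Q)"
        using runs_afterstep[OF less.prems step(2)] by auto
      have "0 < t" using mstep_cost_pos[OF step(2)] .
      then have "runs (Seq c1' c\<^sub>2) s1 ((T - t) + 1 + T\<^sub>2) Q"
        using less.IH[of "T - t"] t by simp
      then show ?thesis using t(1) step(1) by (auto intro: runs_mono)
    qed
  qed
qed

lemma runs_If_bound: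
  assumes "test_cost b s \<le> K"
    and "test_holds b s \<Longrightarrow> runs c\<^sub>1 s T Q" "\<not> test_holds b s \<Longrightarrow> runs c\<^sub>2 s T Q"
  shows "runs (If b c\<^sub>1 c\<^sub>2) s (K + T) Q"
  by (rule runs_step) (use assms in \<open>auto elim!: mstep_IfE intro: runs_mono[of _ _ T]\<close>)

text \<open>The budgets of the branches are added rather than maximized, which keeps all cost
  expressions within the operations covered by \<open>poly_bounded_intros\<close>.\<close>

lemma runs_If:
  assumes "test_cost b s \<le> K"
    and "test_holds b s \<Longrightarrow> runs c\<^sub>1 s T\<^sub>1 Q" "\<not> test_holds b s \<Longrightarrow> runs c\<^sub>2 s T\<^sub>2 Q"
  shows "runs (If b c\<^sub>1 c\<^sub>2) s (K + (T\<^sub>1 + T\<^sub>2)) Q"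
  by (rule runs_If_bound[OF assms(1)]) (use assms in \<open>auto intro: runs_mono\<close>)

definition is_node :: "('r, 'd) val \<Rightarrow> bool" where
  "is_node v \<longleftrightarrow> (\<exists>u w. v = Node u w)"

lemma is_node_simps [simp]:
  "is_node (Node u w)" "\<not> is_node Leaf" "\<not> is_node (Const c)" "\<not> is_node (Rel R)"
  by (auto simp: is_node_def)

lemma test_IsNode: "test_holds (IsNode i) s \<longleftrightarrow> is_node (s i)"
  by (cases "s i") auto

lemma runs_IsNode:
  assumes "is_node (s i) \<Longrightarrow> runs c\<^sub>1 s T\<^sub>1 Q" "\<not> is_node (s i) \<Longrightarrow> runs c\<^sub>2 s T\<^sub>2 Q"
  shows "runs (If (IsNode i) c\<^sub>1 c\<^sub>2) s (1 + (T\<^sub>1 + T\<^sub>2)) Q"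
  by (rule runs_If) (use assms in \<open>auto simp: test_IsNode simp del: test_holds.simps\<close>)

lemma runs_Same:
  assumes "val_size (s i) \<le> N" "val_size (s j) \<le> N"
    and "s i = s j \<Longrightarrow> runs c\<^sub>1 s T\<^sub>1 Q" "s i \<noteq> s j \<Longrightarrow> runs c\<^sub>2 s T\<^sub>2 Q"
  shows "runs (If (Same i j) c\<^sub>1 c\<^sub>2) s (1 + 2 * N + (T\<^sub>1 + T\<^sub>2)) Q"
  by (rule runs_If) (use assms in auto)

lemma runs_Less:
  assumes "s i = Const a" "s j = Const b" "dconst_size a \<le> N" "dconst_size b \<le> N"
    and "num_rel (<) a b \<Longrightarrow> runs c\<^sub>1 s T\<^sub>1 Q" "\<not> num_rel (<) a b \<Longrightarrow> runs c\<^sub>2 s T\<^sub>2 Q"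
  shows "runs (If (Less i j) c\<^sub>1 c\<^sub>2) s (1 + (2 * N)\<^sup>2 + (T\<^sub>1 + T\<^sub>2)) Q"
proof (rule runs_If)
  have "(dconst_size a + dconst_size b)\<^sup>2 \<le> (2 * N)\<^sup>2"
    by (rule power_mono) (use assms in auto)
  then show "test_cost (Less i j) s \<le> 1 + (2 * N)\<^sup>2" by (simp add: assms)
qed (use assms in auto)

lemma runs_While:
  "runs (If b (Seq c (While b c)) SKIP) s T Q \<Longrightarrow> runs (While b c) s (1 + T) Q"
  by (rule runs_step) (auto elim!: mstep_WhileE)

lemma runs_Choice:
  assumes "runs c\<^sub>1 s T\<^sub>1 Q" "runs c\<^sub>2 s T\<^sub>2 Q"
  shows "runs (Choice c\<^sub>1 c\<^sub>2) s (1 + (T\<^sub>1 + T\<^sub>2)) Q"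
  by (rule runs_step) (use assms in \<open>auto elim!: mstep_ChoiceE intro: runs_mono\<close>)

lemmas runs_intros =
  runs_Skip runs_Load runs_Copy runs_MkNode runs_Left runs_Right runs_IsNode runs_Choice

section \<open>Frame reasoning\<close>

fun writes :: "('r, 'd) com \<Rightarrow> nat set" where
  "writes SKIP = {}"
| "writes (Load i v) = {i}"
| "writes (Copy i j) = {i}"
| "writes (MkNode i j k) = {i}"
| "writes (Left i j) = {i}"
| "writes (Right i j) = {i}"
| "writes (Seq c\<^sub>1 c\<^sub>2) = writes c\<^sub>1 \<union> writes c\<^sub>2"
| "writes (If b c\<^sub>1 c\<^sub>2) = writes c\<^sub>1 \<union> writes c\<^sub>2"
| "writes (While b c) = writes c"
| "writes (Choice c\<^sub>1 c\<^sub>2) = writes c\<^sub>1 \<union> writes c\<^sub>2"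

definition agree_except :: "nat set \<Rightarrow> ('r, 'd) store \<Rightarrow> ('r, 'd) store \<Rightarrow> bool" where
  "agree_except W s s' \<longleftrightarrow> (\<forall>i. i \<notin> W \<longrightarrow> s' i = s i)"

lemma agree_exceptD: "agree_except W s s' \<Longrightarrow> i \<notin> W \<Longrightarrow> s' i = s i"
  by (simp add: agree_except_def)

lemma agree_except_mono: "agree_except V s s' \<Longrightarrow> V \<subseteq> W \<Longrightarrow> agree_except W s s'"
  by (auto simp: agree_except_def)

lemma agree_except_trans:
  "agree_except W s s' \<Longrightarrow> agree_except W s' s'' \<Longrightarrow> agree_except W s s''"
  by (auto simp: agree_except_def)

lemma agree_except_refl: "agree_except W s s"
  by (simp add: agree_except_def)

lemma agree_except_upd: "agree_except W s s' \<Longrightarrow> i \<in> W \<Longrightarrow> agree_except W s (s'(i := v))"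
  by (auto simp: agree_except_def)

lemma mstep_writes:
  assumes "mstep (c, s) t (c', s')"
  shows "writes c' \<subseteq> writes c \<and> agree_except (writes c) s s'"
  using assms
proof (induction c arbitrary: c' s')
  case (Seq c1 c2)
  from Seq.prems show ?case
  proof (cases rule: mstep_Seq_cases)
    case skip
    then show ?thesis by (auto simp: agree_except_def)
  next
    case (step c1' s1)
    then show ?thesis using Seq.IH(1)[OF step(2)] by (auto intro: agree_except_mono)
  qed
qed (auto elim!: mstep_SkipE mstep_LoadE mstep_CopyE mstep_MkNodeE mstep_LeftE
  mstep_RightE mstep_IfE mstep_WhileE mstep_ChoiceE simp: agree_except_def split: if_splits)

lemma msteps_writes:
  "msteps (c, s) t (c', s') \<Longrightarrow> writes c' \<subseteq> writes c \<and> agree_except (writes c) s s'"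
proof (induction "(c, s)" t "(c', s')" arbitrary: c s rule: msteps.induct)
  case (step t cfg u)
  obtain c1 s1 where cfg: "cfg = (c1, s1)" by fastforce
  have "writes c1 \<subseteq> writes c" "agree_except (writes c) s s1"
    using mstep_writes[OF step.hyps(1)[unfolded cfg]] by auto
  moreover have "writes c' \<subseteq> writes c1" "agree_except (writes c1) s1 s'"
    using step.hyps(3)[OF cfg] by auto
  ultimately show ?case
    using agree_except_trans[OF _ agree_except_mono] by blast
qed (simp add: agree_except_refl)

lemma runs_frame:
  "runs c s T Q \<Longrightarrow> runs c s T (\<lambda>s'. Q s' \<and> agree_except (writes c) s s')"
  unfolding runs_def using msteps_writes by blast

text \<open>Lets a specification mention only the registers that carry its result; the contents of
  all others are recovered from the syntactic set of written registers.\<close>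

lemma runs_Seq_frame:
  assumes "runs c\<^sub>1 s T\<^sub>1 R"
    and "\<And>s'. R s' \<Longrightarrow> agree_except (writes c\<^sub>1) s s' \<Longrightarrow> runs c\<^sub>2 s' T\<^sub>2 Q"
  shows "runs (Seq c\<^sub>1 c\<^sub>2) s (T\<^sub>1 + 1 + T\<^sub>2) Q"
  by (rule runs_Seq, rule runs_conseq[OF runs_frame[OF assms(1)]]) (auto intro: assms(2))

section \<open>Existence of halting executions\<close>

lemma msteps_trans: "msteps a t b \<Longrightarrow> msteps b u c \<Longrightarrow> msteps a (t + u) c"
  by (induction rule: msteps.induct) (auto simp: add.assoc intro: msteps.step)

lemma msteps_Seq: "msteps (c\<^sub>1, s) t (c', s') \<Longrightarrow> msteps (Seq c\<^sub>1 c\<^sub>2, s) t (Seq c' c\<^sub>2, s')"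
proof (induction "(c\<^sub>1, s)" t "(c', s')" arbitrary: c\<^sub>1 s rule: msteps.induct)
  case (step t cfg u)
  then show ?case by (cases cfg) (blast intro: msteps.step mstep.Seq)
qed (rule msteps.refl)

lemma exec_first: "mstep (c, s) t (c', s') \<Longrightarrow> exec c' s' s'' \<Longrightarrow> exec c s s''"
  unfolding exec_def by (blast intro: msteps.step)

lemma exec_Skip: "exec SKIP s s"
  unfolding exec_def by (blast intro: msteps.refl)

lemma exec_Seq: "exec c\<^sub>1 s s' \<Longrightarrow> exec c\<^sub>2 s' s'' \<Longrightarrow> exec (Seq c\<^sub>1 c\<^sub>2) s s''"
  unfolding exec_def by (blast intro: msteps_trans msteps_Seq msteps.step mstep.Seq_Skip)

text \<open>A command other than \<open>SKIP\<close> can always step, and each step uses up budget,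
  so some run halts; its final store satisfies \<open>Q\<close> as all of them do.\<close>

lemma runs_exec:
  assumes "runs c s T Q" shows "\<exists>s'. exec c s s' \<and> Q s'"
  using assms
proof (induction T arbitrary: c s rule: less_induct)
  case (less T)
  show ?case
  proof (cases "c = SKIP")
    case True
    then show ?thesis using less.prems by (blast dest: runs_SkipD intro: exec_Skip)
  next
    case False
    then obtain t c' s' where st: "mstep (c, s) t (c', s')" using mstep_progress by (metis surj_pair)
    have "0 < t" "t \<le> T" "runs c' s' (T - t) Q"
      using mstep_cost_pos[OF st] runs_afterstep[OF less.prems st] by auto
    then show ?thesis using less.IH[of "T - t" c' s'] exec_first[OF st] by auto
  qed
qed

lemma runs_execD: "runs c s T Q \<Longrightarrow> exec c s s' \<Longrightarrow> Q s'"
  unfolding runs_def exec_def by blast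

lemma exec_While_step:
  assumes "is_node (s i)" "exec c s s'" "exec (While (IsNode i) c) s' s''"
  shows "exec (While (IsNode i) c) s s''"
proof -
  have "exec (Seq c (While (IsNode i) c)) s s''" using exec_Seq assms(2,3) .
  moreover have "mstep (If (IsNode i) (Seq c (While (IsNode i) c)) SKIP, s)
      (test_cost (IsNode i) s) (Seq c (While (IsNode i) c), s)"
    using mstep.If[of "IsNode i" "Seq c (While (IsNode i) c)" SKIP s] assms(1)
    by (simp add: test_IsNode del: test_holds.simps)
  ultimately have "exec (If (IsNode i) (Seq c (While (IsNode i) c)) SKIP) s s''"
    by (rule exec_first[rotated])
  then show ?thesis by (rule exec_first[OF mstep.While])
qed

lemma exec_While_stop:
  assumes "\<not> is_node (s i)" shows "exec (While (IsNode i) c) s s"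
proof -
  have "mstep (If (IsNode i) (Seq c (While (IsNode i) c)) SKIP, s)
      (test_cost (IsNode i) s) (SKIP, s)"
    using mstep.If[of "IsNode i" "Seq c (While (IsNode i) c)" SKIP s] assms(1)
    by (simp add: test_IsNode del: test_holds.simps)
  then have "exec (If (IsNode i) (Seq c (While (IsNode i) c)) SKIP) s s"
    by (rule exec_first) (rule exec_Skip)
  then show ?thesis by (rule exec_first[OF mstep.While])
qed

section \<open>Iterating over lists\<close>

text \<open>Kept apart from \<open>foreach\<close>, which protects the original list by a copy, so
  that inductions can speak of a list already partly consumed in \<open>it\<close>.\<close>

definition scan :: "nat \<Rightarrow> nat \<Rightarrow> ('r, 'd) com \<Rightarrow> ('r, 'd) com" where
  "scan it e c = While (IsNode it) (Seq (Left e it) (Seq (Right it it) c))"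

definition foreach :: "nat \<Rightarrow> nat \<Rightarrow> nat \<Rightarrow> ('r, 'd) com \<Rightarrow> ('r, 'd) com" where
  "foreach r it e c = Seq (Copy it r) (scan it e c)"

lemma writes_scan [simp]: "writes (scan it e c) = {it, e} \<union> writes c"
  by (auto simp: scan_def)

lemma writes_foreach [simp]: "writes (foreach r it e c) = {it, e} \<union> writes c"
  by (auto simp: foreach_def)

text \<open>The loop body may depend on the iteration only through one accumulator register \<open>a\<close>.\<close>

lemma runs_scan:
  assumes it: "it \<notin> writes c" "it \<noteq> e" "a \<noteq> it" "a \<noteq> e"
    and body: "\<And>d x rest s. xs = d @ x # rest \<Longrightarrow> I d (s a) \<Longrightarrow> s e = g x \<Longrightarrow>
      agree_except ({it, e} \<union> writes c) s0 s \<Longrightarrow> runs c s B (\<lambda>s'. I (d @ [x]) (s' a))"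
    and "xs = d @ rest" "I d (s a)" "s it = list_val (map g rest)"
    and "agree_except ({it, e} \<union> writes c) s0 s"
  shows "runs (scan it e c) s (length rest * (B + 7) + 2) (\<lambda>s'. I xs (s' a))"
  using assms(6-)
proof (induction rest arbitrary: d s)
  case Nil
  have "runs (scan it e c) s (1 + (1 + 0)) (\<lambda>s'. I xs (s' a))"
    unfolding scan_def
    by (intro runs_While runs_If_bound runs_Skip)
       (use Nil in \<open>simp_all add: test_IsNode del: test_holds.simps\<close>)
  then show ?case by (rule runs_mono) simp
next
  case (Cons x rest)
  let ?s = "s(e := g x, it := list_val (map g rest))"
  have ag: "agree_except ({it, e} \<union> writes c) s0 ?s"
    using Cons.prems(4) by (simp add: agree_except_upd)
  have b: "runs c ?s B (\<lambda>s'. I (d @ [x]) (s' a))"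
    using ag it Cons.prems by (intro body) auto
  have tail: "runs (scan it e c) s' (length rest * (B + 7) + 2) (\<lambda>s'. I xs (s' a))"
    if s': "I (d @ [x]) (s' a)" "agree_except (writes c) ?s s'" for s'
  proof (rule Cons.IH)
    show "xs = (d @ [x]) @ rest" using Cons.prems(1) by simp
    show "I (d @ [x]) (s' a)" by fact
    show "s' it = list_val (map g rest)" using agree_exceptD[OF s'(2) it(1)] by simp
    show "agree_except ({it, e} \<union> writes c) s0 s'"
      using ag s'(2) by (meson agree_except_mono agree_except_trans sup_ge2)
  qed
  have loop: "runs c ?s B
      (\<lambda>s'. runs (scan it e c) s' (length rest * (B + 7) + 2) (\<lambda>s'. I xs (s' a)))"
    by (rule runs_conseq[OF runs_frame[OF b]]) (auto intro: tail simp del: add_2_eq_Suc')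
  \<comment> \<open>The overhead \<open>7\<close> per element: unfolding the loop, its test, two
    projections and three sequencing steps. The final \<open>2\<close> is one more unfolding with a
    failing test.\<close>
  have "runs (While (IsNode it) (Seq (Left e it) (Seq (Right it it) c))) s
      (1 + (1 + (1 + 1 + (1 + 1 + B) + 1 + (length rest * (B + 7) + 2)))) (\<lambda>s'. I xs (s' a))"
    by (intro runs_While runs_If_bound runs_Seq runs_Left runs_Right)
       (use Cons.prems(3) it loop in
         \<open>simp_all add: scan_def test_IsNode del: test_holds.simps\<close>)
  then show ?case unfolding scan_def by (rule runs_mono) simp
qed

lemma runs_foreach:
  assumes it: "it \<notin> writes c" "it \<noteq> e" "a \<noteq> it" "a \<noteq> e"
    and "s r = list_val (map g xs)" "length xs \<le> N" "I [] (s a)"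
    and body: "\<And>d x rest s'. xs = d @ x # rest \<Longrightarrow> I d (s' a) \<Longrightarrow> s' e = g x \<Longrightarrow>
      agree_except ({it, e} \<union> writes c) s s' \<Longrightarrow> runs c s' B (\<lambda>s'. I (d @ [x]) (s' a))"
  shows "runs (foreach r it e c) s (N * (B + 7) + 4) (\<lambda>s'. I xs (s' a))"
proof -
  have "runs (scan it e c) (s(it := s r)) (length xs * (B + 7) + 2) (\<lambda>s'. I xs (s' a))"
  proof (rule runs_scan[where d = "[]" and ?s0.0 = s and xs = xs and I = I and g = g])
    show "agree_except ({it, e} \<union> writes c) s (s(it := s r))"
      by (simp add: agree_except_upd agree_except_refl)
  qed (use assms in auto)
  then have "runs (foreach r it e c) s (1 + 1 + (length xs * (B + 7) + 2)) (\<lambda>s'. I xs (s' a))"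
    unfolding foreach_def by (intro runs_Seq runs_Copy)
  moreover have "length xs * (B + 7) \<le> N * (B + 7)" using assms(6) by (rule mult_le_mono1)
  ultimately show ?thesis by (auto intro: runs_mono)
qed

section \<open>Polynomial bounds and sizes of encodings\<close>

definition poly_bounded :: "(nat \<Rightarrow> nat) \<Rightarrow> bool" where
  "poly_bounded f \<longleftrightarrow> (\<exists>p. \<forall>n. f n \<le> poly p n)"

named_theorems poly_bounded_intros

lemma poly_bounded_const [poly_bounded_intros]: "poly_bounded (\<lambda>n. c)"
  unfolding poly_bounded_def by (rule exI[of _ "[:c:]"]) simp

lemma poly_bounded_id [poly_bounded_intros]: "poly_bounded (\<lambda>n. n)"
  unfolding poly_bounded_def by (rule exI[of _ "[:0, 1:]"]) simp

lemma poly_bounded_add [poly_bounded_intros]: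
  assumes "poly_bounded f" "poly_bounded g" shows "poly_bounded (\<lambda>n. f n + g n)"
proof -
  obtain p q where "\<forall>n. f n \<le> poly p n" "\<forall>n. g n \<le> poly q n"
    using assms unfolding poly_bounded_def by blast
  then have "\<forall>n. f n + g n \<le> poly (p + q) n" by (simp add: add_mono)
  then show ?thesis unfolding poly_bounded_def by blast
qed

lemma poly_bounded_mult [poly_bounded_intros]:
  assumes "poly_bounded f" "poly_bounded g" shows "poly_bounded (\<lambda>n. f n * g n)"
proof -
  obtain p q where "\<forall>n. f n \<le> poly p n" "\<forall>n. g n \<le> poly q n"
    using assms unfolding poly_bounded_def by blast
  then have "\<forall>n. f n * g n \<le> poly (p * q) n" by (simp add: mult_le_mono)
  then show ?thesis unfolding poly_bounded_def by blast
qed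

lemma poly_bounded_square [poly_bounded_intros]:
  "poly_bounded f \<Longrightarrow> poly_bounded (\<lambda>n. (f n)\<^sup>2)"
  unfolding power2_eq_square by (rule poly_bounded_mult)

lemma val_size_list_val: "val_size (list_val vs) = 1 + (\<Sum>v\<leftarrow>vs. 1 + val_size v)"
  by (induction vs) auto

lemma list_val_bounds:
  assumes "val_size (list_val (map g xs)) \<le> N"
  shows "length xs \<le> N" "x \<in> set xs \<Longrightarrow> val_size (g x) \<le> N"
proof -
  have "length xs \<le> val_size (list_val (map g xs))" by (induction xs) auto
  then show "length xs \<le> N" using assms by simp
  have "x \<in> set xs \<Longrightarrow> val_size (g x) \<le> val_size (list_val (map g xs))"
    by (induction xs) auto
  then show "x \<in> set xs \<Longrightarrow> val_size (g x) \<le> N" using assms by simp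
qed

text \<open>Lists encode sets without repetition, so the size is a sum over the set and independent
  of the order. This is what bounds every intermediate list by the input.\<close>

lemma encodes_set_size_mono:
  assumes "encodes_set enc A v" "encodes_set enc B w" "A \<subseteq> B"
  shows "val_size v \<le> val_size w"
proof -
  have size: "val_size u = 1 + (\<Sum>x\<in>C. 1 + val_size (enc x))"
    if "encodes_set enc C u" for C u
    using that by (auto simp: encodes_set_def val_size_list_val o_def sum_list_distinct_conv_sum_set)
  have "finite B" using assms(2) by (auto simp: encodes_set_def)
  then show ?thesis using size[OF assms(1)] size[OF assms(2)]
      sum_mono2[OF _ assms(3), of "\<lambda>x. 1 + val_size (enc x)"] by simp
qed

lemma encodes_set_is_node: "encodes_set enc A v \<Longrightarrow> is_node v \<longleftrightarrow> A \<noteq> {}"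
proof -
  assume "encodes_set enc A v"
  then obtain xs where "set xs = A" "v = list_val (map enc xs)" by (auto simp: encodes_set_def)
  then show ?thesis by (cases xs) auto
qed

lemma list_val_Const_inj: "list_val (map Const t) = list_val (map Const u) \<longleftrightarrow> t = u"
  by (induction t arbitrary: u; case_tac u) auto

text \<open>Ensures that \<open>Same\<close> on encodings decides equality of facts.\<close>

lemma fact_val_inj [simp]: "fact_val x = fact_val y \<longleftrightarrow> x = y"
  by (cases x; cases y) (auto simp: list_val_Const_inj)

section \<open>Testing conditions\<close>

text \<open>Register allocation: 0 to 3 as prescribed by \<open>represents\<close>; 4 the chosen fact;
  13 a flag; 14 the list of facts tested for consistency; 21 the truth value of a condition;
  the rest up to 20 is scratch space. Variables and loop counters occupy the even and odd
  registers from 22 on.\<close>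

definition var_reg :: "nat \<Rightarrow> nat" where
  "var_reg x = 22 + 2 * x"

definition iter_reg :: "nat \<Rightarrow> nat" where
  "iter_reg n = 23 + 2 * n"

lemma reg_neq [simp]:
  "var_reg x = var_reg y \<longleftrightarrow> x = y"
  "iter_reg m = iter_reg n \<longleftrightarrow> m = n"
  "var_reg x \<noteq> iter_reg n" "iter_reg n \<noteq> var_reg x"
  by (auto simp: var_reg_def iter_reg_def) presburger+

lemma small_reg_neq [simp]:
  "k < 22 \<Longrightarrow> var_reg x \<noteq> k" "k < 22 \<Longrightarrow> k \<noteq> var_reg x"
  "k < 22 \<Longrightarrow> iter_reg x \<noteq> k" "k < 22 \<Longrightarrow> k \<noteq> iter_reg x"
  by (auto simp: var_reg_def iter_reg_def)

text \<open>Flags are read by \<open>IsNode\<close>: a node means true, \<open>Leaf\<close>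
  false.\<close>

abbreviation yes_val :: "('r, 'd) val" where
  "yes_val \<equiv> Node Leaf Leaf"

fun term_com :: "nat \<Rightarrow> 'd trm \<Rightarrow> ('r, 'd) com" where
  "term_com r (Var x) = Copy r (var_reg x)"
| "term_com r (Con c) = Load r (Const c)"

text \<open>Only numbers are related by \<open>LE\<close> and \<open>GE\<close> to themselves, and a constant is
  a number iff it is comparable with \<open>0\<close>.\<close>

definition le_com :: "nat \<Rightarrow> nat \<Rightarrow> ('r, 'd) com" where
  "le_com i j = If (Less i j) (Load 21 yes_val) (If (Same i j)
     (Seq (Load 18 (Const (Num 0))) (If (Less i 18) (Load 21 yes_val)
       (If (Less 18 i) (Load 21 yes_val) (If (Same 18 i) (Load 21 yes_val) SKIP)))) SKIP)"

fun cmp_com :: "cmp \<Rightarrow> ('r, 'd) com" where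
  "cmp_com EQ = If (Same 19 20) (Load 21 yes_val) SKIP"
| "cmp_com NEQ = If (Same 19 20) SKIP (Load 21 yes_val)"
| "cmp_com LT = If (Less 19 20) (Load 21 yes_val) SKIP"
| "cmp_com GT = If (Less 20 19) (Load 21 yes_val) SKIP"
| "cmp_com LE = le_com 19 20"
| "cmp_com GE = le_com 20 19"

fun qf_com :: "'d qf \<Rightarrow> ('r, 'd) com" where
  "qf_com (Cmp p a b) =
     Seq (Load 21 Leaf) (Seq (term_com 19 a) (Seq (term_com 20 b) (cmp_com p)))"
| "qf_com (Neg f) = Seq (qf_com f) (If (IsNode 21) (Load 21 Leaf) (Load 21 yes_val))"
| "qf_com (Conj f g) = Seq (qf_com f) (If (IsNode 21) (qf_com g) SKIP)"
| "qf_com (Disj f g) = Seq (qf_com f) (If (IsNode 21) SKIP (qf_com g))"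

lemma writes_term_com [simp]: "writes (term_com r t) = {r}"
  by (cases t) auto

lemma writes_qf_com: "writes (qf_com f) \<subseteq> {18, 19, 20, 21}"
proof (induction f)
  case (Cmp p a b)
  show ?case by (cases p) (auto simp: le_com_def)
qed auto

lemma num_rel_cases:
  "num_rel (\<le>) a b \<longleftrightarrow> num_rel (<) a b \<or>
     a = b \<and> (num_rel (<) a (Num 0) \<or> num_rel (<) (Num 0) a \<or> a = Num 0)"
  "num_rel (\<ge>) a b \<longleftrightarrow> num_rel (\<le>) b a" "num_rel (>) a b \<longleftrightarrow> num_rel (<) b a"
  by (cases a; cases b; auto)+

lemma num_rel_less_irrefl [simp]: "\<not> num_rel (<) a a"
  by (cases a) auto

lemma runs_le_com:
  assumes "{i, j} = {19, 20}" "s i = Const a" "s j = Const b" "\<not> is_node (s 21)"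
    and M: "dconst_size a \<le> M" "dconst_size b \<le> M" "2 \<le> M"
  shows "runs (le_com i j) s (20 + 10 * M + 4 * (2 * M)\<^sup>2)
    (\<lambda>s'. is_node (s' 21) \<longleftrightarrow> num_rel (\<le>) a b)"
proof -
  have ij: "i \<noteq> 18" "j \<noteq> 18" "i \<noteq> 21" "j \<noteq> 21" using assms(1) by (auto simp: doubleton_eq_iff)
  \<comment> \<open>The fraction 0/1 has size \<open>1 + 0 + 1\<close>, which explains the
    hypothesis \<open>2 \<le> M\<close>.\<close>
  have size0: "dconst_size (Num 0) \<le> M" using M(3) by (simp add: bitlen_def floorlog_def)
  let ?s = "s(18 := Const (Num 0))"
  let ?Q = "\<lambda>s'. is_node (s' 21) \<longleftrightarrow> num_rel (\<le>) a b"
  \<comment> \<open>The nested conditionals are verified from the inside out, each under the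
    outcomes of the tests that lead to it.\<close>
  have "runs (If (Same 18 i) (Load 21 yes_val) SKIP) ?s (1 + 2 * M + (1 + 0)) ?Q"
    if "a = b" "\<not> num_rel (<) (Num 0) a" "\<not> num_rel (<) a (Num 0)"
    by (rule runs_Same; (intro runs_intros)?) (use ij that size0 assms in \<open>auto simp: num_rel_cases\<close>)
  then have "runs (If (Less 18 i) (Load 21 yes_val) (If (Same 18 i) (Load 21 yes_val) SKIP)) ?s
      (1 + (2 * M)\<^sup>2 + (1 + (1 + 2 * M + (1 + 0)))) ?Q"
    if "a = b" "\<not> num_rel (<) a (Num 0)"
    by (rule_tac runs_Less[where a = "Num 0" and b = a]; (intro runs_intros)?)
       (use ij that size0 assms in \<open>auto simp: num_rel_cases simp del: dconst_size.simps\<close>)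
  then have "runs (If (Less i 18) (Load 21 yes_val) (If (Less 18 i) (Load 21 yes_val)
      (If (Same 18 i) (Load 21 yes_val) SKIP))) ?s
      (1 + (2 * M)\<^sup>2 + (1 + (1 + (2 * M)\<^sup>2 + (1 + (1 + 2 * M + (1 + 0)))))) ?Q"
    if "a = b"
    by (rule_tac runs_Less[where b = "Num 0" and a = a]; (intro runs_intros)?)
       (use ij that size0 assms in \<open>auto simp: num_rel_cases simp del: dconst_size.simps\<close>)
  then have "runs (If (Same i j)
     (Seq (Load 18 (Const (Num 0))) (If (Less i 18) (Load 21 yes_val)
       (If (Less 18 i) (Load 21 yes_val) (If (Same 18 i) (Load 21 yes_val) SKIP)))) SKIP) s
      (1 + 2 * M + ((1 + 1 +
        (1 + (2 * M)\<^sup>2 + (1 + (1 + (2 * M)\<^sup>2 + (1 + (1 + 2 * M + (1 + 0))))))) + 0)) ?Q"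
    if "\<not> num_rel (<) a b"
    by (rule_tac runs_Same; (intro runs_Seq runs_Load runs_Skip)?)
       (use ij that size0 assms in \<open>auto simp: num_rel_cases simp del: dconst_size.simps\<close>)
  then have "runs (le_com i j) s
     (1 + (2 * M)\<^sup>2 + (1 + (1 + 2 * M + ((1 + 1 +
        (1 + (2 * M)\<^sup>2 + (1 + (1 + (2 * M)\<^sup>2 + (1 + (1 + 2 * M + (1 + 0))))))) + 0)))) ?Q"
    unfolding le_com_def
    by (rule_tac runs_Less[where a = a and b = b]; (intro runs_Load)?)
       (use ij size0 assms in \<open>auto simp: num_rel_cases simp del: dconst_size.simps\<close>)
  then show ?thesis by (rule runs_mono) simp
qed

lemma runs_cmp_com:
  assumes s: "s 19 = Const a" "s 20 = Const b" "\<not> is_node (s 21)"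
    and M: "dconst_size a \<le> M" "dconst_size b \<le> M" "2 \<le> M"
  shows "runs (cmp_com p) s (20 + 10 * M + 4 * (2 * M)\<^sup>2)
    (\<lambda>s'. is_node (s' 21) \<longleftrightarrow> cmp_holds p a b)"
proof -
  have same: "runs (If (Same 19 20) c\<^sub>1 c\<^sub>2) s (20 + 10 * M + 4 * (2 * M)\<^sup>2) Q"
    if "a = b \<Longrightarrow> runs c\<^sub>1 s 1 Q" "a \<noteq> b \<Longrightarrow> runs c\<^sub>2 s 1 Q" for c\<^sub>1 c\<^sub>2 Q
    by (rule runs_mono[OF runs_Same[where N = M]]) (use that s M in auto)
  have less: "runs (If (Less i j) (Load 21 yes_val) SKIP) s (20 + 10 * M + 4 * (2 * M)\<^sup>2)
      (\<lambda>s'. is_node (s' 21) \<longleftrightarrow> num_rel (<) a' b')"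
    if "s i = Const a'" "s j = Const b'" "dconst_size a' \<le> M" "dconst_size b' \<le> M" for i j a' b'
    by (rule runs_mono, rule runs_Less[OF that]; (rule runs_Load runs_Skip)?) (use s in auto)
  show ?thesis
  proof (cases p)
    case EQ
    show ?thesis unfolding EQ cmp_com.simps cmp_holds.simps
      by (intro same runs_Load runs_mono[OF runs_Skip]) (auto simp: s)
  next
    case NEQ
    show ?thesis unfolding NEQ cmp_com.simps cmp_holds.simps
      by (intro same runs_Load runs_mono[OF runs_Skip]) (auto simp: s)
  next
    case LT
    then show ?thesis using less[OF s(1,2) M(1,2)] by simp
  next
    case GT
    then show ?thesis using less[OF s(2,1) M(2,1)] by (simp add: num_rel_cases(3))
  next
    case LE
    then show ?thesis using runs_le_com[OF _ s M] by simp
  next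
    case GE
    then show ?thesis using runs_le_com[OF _ s(2,1,3) M(2,1,3)]
      by (simp add: num_rel_cases(2) insert_commute)
  qed
qed

text \<open>The size bound belongs to the invariant because comparisons are charged by the size of
  their operands.\<close>

definition vars_hold ::
    "nat set \<Rightarrow> ('r, 'd) store \<Rightarrow> (nat \<Rightarrow> 'd dconst) \<Rightarrow> nat \<Rightarrow> bool" where
  "vars_hold V s \<rho> N \<longleftrightarrow> (\<forall>v \<in> V. s (var_reg v) = Const (\<rho> v) \<and> dconst_size (\<rho> v) \<le> N)"

lemma vars_hold_subset: "vars_hold W s \<rho> N \<Longrightarrow> V \<subseteq> W \<Longrightarrow> vars_hold V s \<rho> N"
  by (auto simp: vars_hold_def)

lemma vars_hold_agree:
  "vars_hold V s \<rho> N \<Longrightarrow> agree_except W s s' \<Longrightarrow> W \<inter> var_reg ` V = {} \<Longrightarrow> vars_hold V s' \<rho> N"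
  unfolding vars_hold_def agree_except_def by (metis disjoint_iff imageI)

lemma vars_hold_upd [simp]:
  "k < 22 \<Longrightarrow> vars_hold V (s(k := u)) \<rho> N \<longleftrightarrow> vars_hold V s \<rho> N"
  by (simp add: vars_hold_def)

text \<open>Constants written in a constraint need not be bounded by the input size, but they are
  fixed with the constraint and add only a constant to the bound.\<close>

fun trm_weight :: "'d trm \<Rightarrow> nat" where
  "trm_weight (Var x) = 0"
| "trm_weight (Con c) = dconst_size c"

lemma runs_term_com:
  assumes "vars_hold (trm_vars a) s \<rho> N" "trm_weight a \<le> K" "K \<le> N'" "N \<le> N'"
    and "dconst_size (trm_val \<rho> a) \<le> N' \<Longrightarrow> Q (s(r := Const (trm_val \<rho> a)))"
  shows "runs (term_com r a) s 1 Q"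
  using assms by (cases a) (auto simp: vars_hold_def simp del: One_nat_def intro!: runs_intros)

lemma runs_qf_com:
  "\<exists>T. poly_bounded T \<and> (\<forall>N (s :: ('r, 'd) store) \<rho>. vars_hold (qf_vars f) s \<rho> N \<longrightarrow>
     runs (qf_com f) s (T N) (\<lambda>s'. is_node (s' 21) \<longleftrightarrow> holds \<rho> f))"
proof (induction f)
  case (Cmp p a b)
  \<comment> \<open>The summand \<open>2\<close> is the size of the number \<open>0\<close> that
    \<open>le_com\<close> loads.\<close>
  define K where "K = 2 + trm_weight a + trm_weight b"
  let ?T = "\<lambda>N. 1 + 1 + (1 + 1 + (1 + 1 + (20 + 10 * (N + K) + 4 * (2 * (N + K))\<^sup>2)))"
  have "runs (qf_com (Cmp p a b)) s (?T N) (\<lambda>s'. is_node (s' 21) \<longleftrightarrow> holds \<rho> (Cmp p a b))"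
    if v: "vars_hold (qf_vars (Cmp p a b)) s \<rho> N" for N \<rho> and s :: "('r, 'd) store"
    unfolding qf_com.simps
  proof (intro runs_Seq runs_Load runs_term_com[where N = N and N' = "N + K" and \<rho> = \<rho> and K = K])
    show "vars_hold (trm_vars a) (s(21 := Leaf)) \<rho> N"
      using v by (auto elim: vars_hold_subset)
    show "vars_hold (trm_vars b) (s(21 := Leaf, 19 := Const (trm_val \<rho> a))) \<rho> N"
      using v by (auto elim: vars_hold_subset)
    assume "dconst_size (trm_val \<rho> a) \<le> N + K" "dconst_size (trm_val \<rho> b) \<le> N + K"
    then show "runs (cmp_com p)
        (s(21 := Leaf, 19 := Const (trm_val \<rho> a), 20 := Const (trm_val \<rho> b)))
        (20 + 10 * (N + K) + 4 * (2 * (N + K))\<^sup>2)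
        (\<lambda>s'. is_node (s' 21) \<longleftrightarrow> holds \<rho> (Cmp p a b))"
      unfolding holds.simps by (intro runs_cmp_com) (auto simp: K_def)
  qed (auto simp: K_def)
  moreover have "poly_bounded ?T" by (intro poly_bounded_intros)
  ultimately show ?case by blast
next
  case (Neg f)
  then obtain T where T: "poly_bounded T" "\<And>N (s :: ('r, 'd) store) \<rho>. vars_hold (qf_vars f) s \<rho> N \<Longrightarrow>
      runs (qf_com f) s (T N) (\<lambda>s'. is_node (s' 21) \<longleftrightarrow> holds \<rho> f)" by blast
  let ?T = "\<lambda>N. T N + 1 + (1 + (1 + 1))"
  have "runs (qf_com (Neg f)) s (?T N) (\<lambda>s'. is_node (s' 21) \<longleftrightarrow> holds \<rho> (Neg f))"
    if v: "vars_hold (qf_vars (Neg f)) s \<rho> N" for N \<rho> and s :: "('r, 'd) store"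
    unfolding qf_com.simps
    by (rule runs_Seq_frame[OF T(2)], use v in simp, intro runs_intros) auto
  moreover have "poly_bounded ?T" by (intro poly_bounded_intros T)
  ultimately show ?case by blast
next
  case (Conj f g)
  then obtain T U where T: "poly_bounded T" "\<And>N (s :: ('r, 'd) store) \<rho>. vars_hold (qf_vars f) s \<rho> N \<Longrightarrow>
      runs (qf_com f) s (T N) (\<lambda>s'. is_node (s' 21) \<longleftrightarrow> holds \<rho> f)"
    and U: "poly_bounded U" "\<And>N (s :: ('r, 'd) store) \<rho>. vars_hold (qf_vars g) s \<rho> N \<Longrightarrow>
      runs (qf_com g) s (U N) (\<lambda>s'. is_node (s' 21) \<longleftrightarrow> holds \<rho> g)" by blast
  let ?T = "\<lambda>N. T N + 1 + (1 + (U N + 0))"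
  have "runs (qf_com (Conj f g)) s (?T N) (\<lambda>s'. is_node (s' 21) \<longleftrightarrow> holds \<rho> (Conj f g))"
    if v: "vars_hold (qf_vars (Conj f g)) s \<rho> N" for N \<rho> and s :: "('r, 'd) store"
    unfolding qf_com.simps
  proof (rule runs_Seq_frame[OF T(2)])
    show "vars_hold (qf_vars f) s \<rho> N" using v by (auto elim: vars_hold_subset)
    fix s' assume s': "is_node (s' 21) \<longleftrightarrow> holds \<rho> f" "agree_except (writes (qf_com f)) s s'"
    \<comment> \<open>Evaluating \<open>f\<close> touches only registers 18 to 21, so the registers
      of the variables survive.\<close>
    have "vars_hold (qf_vars g) s' \<rho> N"
      by (rule vars_hold_agree[OF _ agree_except_mono[OF s'(2) writes_qf_com]])
         (use v in \<open>auto elim: vars_hold_subset\<close>)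
    then show "runs (If (IsNode 21) (qf_com g) SKIP) s' (1 + (U N + 0))
        (\<lambda>s'. is_node (s' 21) \<longleftrightarrow> holds \<rho> (Conj f g))"
      by (intro runs_IsNode runs_Skip) (use s' U(2) in auto)
  qed
  moreover have "poly_bounded ?T" by (intro poly_bounded_intros T U)
  ultimately show ?case by blast
next
  case (Disj f g)
  then obtain T U where T: "poly_bounded T" "\<And>N (s :: ('r, 'd) store) \<rho>. vars_hold (qf_vars f) s \<rho> N \<Longrightarrow>
      runs (qf_com f) s (T N) (\<lambda>s'. is_node (s' 21) \<longleftrightarrow> holds \<rho> f)"
    and U: "poly_bounded U" "\<And>N (s :: ('r, 'd) store) \<rho>. vars_hold (qf_vars g) s \<rho> N \<Longrightarrow>
      runs (qf_com g) s (U N) (\<lambda>s'. is_node (s' 21) \<longleftrightarrow> holds \<rho> g)" by blast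
  let ?T = "\<lambda>N. T N + 1 + (1 + (0 + U N))"
  have "runs (qf_com (Disj f g)) s (?T N) (\<lambda>s'. is_node (s' 21) \<longleftrightarrow> holds \<rho> (Disj f g))"
    if v: "vars_hold (qf_vars (Disj f g)) s \<rho> N" for N \<rho> and s :: "('r, 'd) store"
    unfolding qf_com.simps
  proof (rule runs_Seq_frame[OF T(2)])
    show "vars_hold (qf_vars f) s \<rho> N" using v by (auto elim: vars_hold_subset)
    fix s' assume s': "is_node (s' 21) \<longleftrightarrow> holds \<rho> f" "agree_except (writes (qf_com f)) s s'"
    have "vars_hold (qf_vars g) s' \<rho> N"
      by (rule vars_hold_agree[OF _ agree_except_mono[OF s'(2) writes_qf_com]])
         (use v in \<open>auto elim: vars_hold_subset\<close>)
    then show "runs (If (IsNode 21) SKIP (qf_com g)) s' (1 + (0 + U N))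
        (\<lambda>s'. is_node (s' 21) \<longleftrightarrow> holds \<rho> (Disj f g))"
      by (intro runs_IsNode runs_Skip) (use s' U(2) in auto)
  qed
  moreover have "poly_bounded ?T" by (intro poly_bounded_intros T U)
  ultimately show ?case by blast
qed

section \<open>Testing consistency\<close>

text \<open>The command continues with \<open>k\<close> once the arguments listed in register 16 match \<open>xs\<close>,
  where the variables in \<open>V\<close> are already bound.\<close>

fun match_com :: "nat set \<Rightarrow> nat list \<Rightarrow> ('r, 'd) com \<Rightarrow> ('r, 'd) com" where
  "match_com V [] k = If (IsNode 16) SKIP k"
| "match_com V (x # xs) k =
     If (IsNode 16) (Seq (Left 17 16) (Seq (Right 16 16)
       (if x \<in> V then If (Same 17 (var_reg x)) (match_com V xs k) SKIP
        else Seq (Copy (var_reg x) 17) (match_com (insert x V) xs k)))) SKIP"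

text \<open>A join in continuation style: the loops for the remaining atoms run inside the match for
  the current one. \<open>length as\<close> decreases inwards and so gives each loop its own
  counter, whereas register 15 can be shared because it is read before the inner loops
  start.\<close>

fun atoms_com :: "nat set \<Rightarrow> ('r \<times> nat list) list \<Rightarrow> ('r, 'd) com \<Rightarrow> ('r, 'd) com" where
  "atoms_com V [] k = k"
| "atoms_com V ((R, xs) # as) k = foreach 14 (iter_reg (length as)) 15
     (Seq (Left 17 15) (Seq (Load 18 (Rel R)) (If (Same 17 18)
       (Seq (Right 16 15) (match_com V xs (atoms_com (V \<union> set xs) as k))) SKIP)))"

lemma writes_match_com:
  "writes (match_com V xs k) \<subseteq> {16, 17} \<union> var_reg ` (- V) \<union> writes k"
  by (induction V xs k rule: match_com.induct) auto

text \<open>Apart from the writes of \<open>k\<close>, variables bound in \<open>V\<close> and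
  counters of enclosing loops are spared, so an enclosing loop resumes undisturbed.\<close>

lemma writes_atoms_com:
  "writes (atoms_com V as k) \<subseteq>
     {15, 16, 17, 18} \<union> iter_reg ` {..<length as} \<union> var_reg ` (- V) \<union> writes k"
proof (induction V as k rule: atoms_com.induct)
  case (2 V R xs as k)
  have "writes (match_com V xs (atoms_com (V \<union> set xs) as k)) \<subseteq>
      {15, 16, 17, 18} \<union> iter_reg ` {..<length as} \<union> var_reg ` (- V) \<union> writes k"
    using writes_match_com[of V xs "atoms_com (V \<union> set xs) as k"] 2 by blast
  then show ?case by (auto simp: lessThan_Suc)
qed auto

text \<open>The flag in register 13 is only ever raised. Repeating such a command therefore computes
  a disjunction, and a loop over facts computes an existential quantifier.\<close>

definition tests_com ::
    "nat set \<Rightarrow> ('r, 'd) com \<Rightarrow> (('r, 'd) fact set \<Rightarrow> (nat \<Rightarrow> 'd dconst) \<Rightarrow> bool) \<Rightarrow>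
     (nat \<Rightarrow> nat) \<Rightarrow> bool" where
  "tests_com W k H T \<longleftrightarrow>
     (\<forall>N s \<rho> fs. s 14 = list_val (map fact_val fs) \<and> val_size (s 14) \<le> N \<and> vars_hold W s \<rho> N \<longrightarrow>
        runs k s (T N) (\<lambda>s'. is_node (s' 13) \<longleftrightarrow> is_node (s 13) \<or> H (set fs) \<rho>))"

lemma tests_comD:
  "tests_com W k H T \<Longrightarrow> s 14 = list_val (map fact_val fs) \<Longrightarrow> val_size (s 14) \<le> N \<Longrightarrow>
   vars_hold W s \<rho> N \<Longrightarrow>
   runs k s (T N) (\<lambda>s'. is_node (s' 13) \<longleftrightarrow> is_node (s 13) \<or> H (set fs) \<rho>)"
  unfolding tests_com_def by blast

text \<open>Matching determines the values on \<open>set xs\<close>, so the search for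
  \<open>\<rho>'\<close> has at most one relevant outcome; the hypothesis on \<open>H\<close> says
  that values of other variables do not affect it.\<close>

lemma runs_match_com:
  fixes k :: "('r, 'd) com"
  assumes "tests_com (V \<union> set xs) k H T" "poly_bounded T"
    and H: "\<And>A \<rho> \<rho>'. (\<forall>v \<in> V \<union> set xs. \<rho> v = \<rho>' v) \<Longrightarrow> H A \<rho> = H A \<rho>'"
  shows "\<exists>T'. poly_bounded T' \<and> (\<forall>N s \<rho> fs ts.
     s 14 = list_val (map fact_val fs) \<and> val_size (s 14) \<le> N \<and> vars_hold V s \<rho> N \<and>
     s 16 = list_val (map Const ts) \<and> val_size (s 16) \<le> N \<longrightarrow>
     runs (match_com V xs k) s (T' N) (\<lambda>s'. is_node (s' 13) \<longleftrightarrow> is_node (s 13) \<or>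
       (\<exists>\<rho>'. (\<forall>v \<in> V. \<rho>' v = \<rho> v) \<and> map \<rho>' xs = ts \<and> H (set fs) \<rho>')))"
  using assms
proof (induction xs arbitrary: V)
  case Nil
  let ?T = "\<lambda>N. 1 + (0 + T N)"
  have "runs (match_com V [] k) s (?T N) (\<lambda>s'. is_node (s' 13) \<longleftrightarrow> is_node (s 13) \<or>
       (\<exists>\<rho>'. (\<forall>v \<in> V. \<rho>' v = \<rho> v) \<and> map \<rho>' [] = ts \<and> H (set fs) \<rho>'))"
    if s: "s 14 = list_val (map fact_val fs)" "val_size (s 14) \<le> N" "vars_hold V s \<rho> N"
      "s 16 = list_val (map Const ts)" for N s \<rho> fs ts
  proof -
    have "(\<exists>\<rho>'. (\<forall>v \<in> V. \<rho>' v = \<rho> v) \<and> H (set fs) \<rho>') \<longleftrightarrow> H (set fs) \<rho>"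
      using Nil.prems(3) by (metis (no_types, lifting) Un_empty_right list.set(1))
    moreover have "runs k s (T N) (\<lambda>s'. is_node (s' 13) \<longleftrightarrow> is_node (s 13) \<or> H (set fs) \<rho>)"
      by (rule tests_comD[OF Nil.prems(1)]) (use s in auto)
    ultimately show ?thesis unfolding match_com.simps
      by (intro runs_intros) (use s in \<open>cases ts; simp\<close>)+
  qed
  moreover have "poly_bounded ?T" by (intro poly_bounded_intros Nil.prems)
  ultimately show ?case by blast
next
  case (Cons x xs)
  have V: "insert x V \<union> set xs = V \<union> set (x # xs)" by auto
  from Cons.IH[of "insert x V"] Cons.prems obtain T' where T': "poly_bounded T'"
    "\<And>N s \<rho> fs ts. s 14 = list_val (map fact_val fs) \<Longrightarrow> val_size (s 14) \<le> N \<Longrightarrow>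
      vars_hold (insert x V) s \<rho> N \<Longrightarrow> s 16 = list_val (map Const ts) \<Longrightarrow> val_size (s 16) \<le> N \<Longrightarrow>
      runs (match_com (insert x V) xs k) s (T' N) (\<lambda>s'. is_node (s' 13) \<longleftrightarrow> is_node (s 13) \<or>
       (\<exists>\<rho>'. (\<forall>v \<in> insert x V. \<rho>' v = \<rho> v) \<and> map \<rho>' xs = ts \<and> H (set fs) \<rho>'))"
    unfolding V by blast
  \<comment> \<open>One bound for both branches: \<open>1 + 2 * N\<close> pays for the comparison
    with a bound variable, \<open>2\<close> for copying into an unbound one.\<close>
  let ?T = "\<lambda>N. 1 + ((1 + 1 + (1 + 1 + (1 + 2 * N + (T' N + 2)))) + 0)"
  have "runs (match_com V (x # xs) k) s (?T N) (\<lambda>s'. is_node (s' 13) \<longleftrightarrow> is_node (s 13) \<or>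
       (\<exists>\<rho>'. (\<forall>v \<in> V. \<rho>' v = \<rho> v) \<and> map \<rho>' (x # xs) = ts \<and> H (set fs) \<rho>'))"
    (is "runs _ _ _ ?Q")
    if s: "s 14 = list_val (map fact_val fs)" "val_size (s 14) \<le> N" "vars_hold V s \<rho> N"
      "s 16 = list_val (map Const ts)" "val_size (s 16) \<le> N" for N s \<rho> fs ts
  proof (cases ts)
    case Nil
    then show ?thesis unfolding match_com.simps
      by (intro runs_mono[OF runs_IsNode[where T\<^sub>2 = 0 and T\<^sub>1 = 0]] runs_Skip) (use s in auto)
  next
    case (Cons t us)
    let ?s = "s(17 := Const t, 16 := list_val (map Const us))"
    have t: "dconst_size t \<le> N" "val_size (list_val (map Const us) :: ('r, 'd) val) \<le> N"
      using s(4,5) Cons by auto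
    have rest: "runs (if x \<in> V then If (Same 17 (var_reg x)) (match_com V xs k) SKIP
        else Seq (Copy (var_reg x) 17) (match_com (insert x V) xs k)) ?s
        (1 + 2 * N + (T' N + 2)) ?Q"
    proof (cases "x \<in> V")
      case True
      then have x: "s (var_reg x) = Const (\<rho> x)" "dconst_size (\<rho> x) \<le> N"
        using s(3) by (auto simp: vars_hold_def)
      have ins: "insert x V = V" using True by auto
      have ex: "(\<exists>\<rho>'. (\<forall>v \<in> V. \<rho>' v = \<rho> v) \<and> map \<rho>' (x # xs) = ts \<and> H (set fs) \<rho>') \<longleftrightarrow>
          \<rho> x = t \<and> (\<exists>\<rho>'. (\<forall>v \<in> V. \<rho>' v = \<rho> v) \<and> map \<rho>' xs = us \<and> H (set fs) \<rho>')"
        using True Cons by auto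
      have "runs (If (Same 17 (var_reg x)) (match_com V xs k) SKIP) ?s (1 + 2 * N + (T' N + 0)) ?Q"
      proof (rule runs_Same)
        assume "?s 17 = ?s (var_reg x)"
        then have "t = \<rho> x" using x by simp
        then show "runs (match_com V xs k) ?s (T' N) ?Q"
          using T'(2)[of ?s fs N \<rho> us] s t unfolding ex ins by simp
      next
        assume "?s 17 \<noteq> ?s (var_reg x)"
        then have "t \<noteq> \<rho> x" using x by simp
        then show "runs SKIP ?s 0 ?Q" unfolding ex by (intro runs_Skip) simp
      qed (use x t in auto)
      then show ?thesis using True by (auto intro: runs_mono)
    next
      case False
      let ?\<rho> = "\<rho>(x := t)"
      have ex: "(\<exists>\<rho>'. (\<forall>v \<in> V. \<rho>' v = \<rho> v) \<and> map \<rho>' (x # xs) = ts \<and> H (set fs) \<rho>') \<longleftrightarrow>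
          (\<exists>\<rho>'. (\<forall>v \<in> insert x V. \<rho>' v = ?\<rho> v) \<and> map \<rho>' xs = us \<and> H (set fs) \<rho>')"
        using False Cons by (intro iff_exI) auto
      have "vars_hold (insert x V) (?s(var_reg x := ?s 17)) ?\<rho> N"
        using s(3) t False by (auto simp: vars_hold_def)
      then have "runs (match_com (insert x V) xs k) (?s(var_reg x := ?s 17)) (T' N) ?Q"
        using T'(2)[of "?s(var_reg x := ?s 17)" fs N ?\<rho> us] s t unfolding ex by simp
      then have "runs (Seq (Copy (var_reg x) 17) (match_com (insert x V) xs k)) ?s
          (1 + 1 + T' N) ?Q"
        by (intro runs_Seq runs_Copy)
      then show ?thesis using False by (auto intro: runs_mono)
    qed
    show ?thesis unfolding match_com.simps
      by (intro runs_IsNode runs_Seq runs_Left runs_Right runs_Skip) (use s Cons rest in auto)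
  qed
  moreover have "poly_bounded ?T" by (intro poly_bounded_intros T')
  ultimately show ?case by blast
qed

text \<open>Each atom adds one loop with at most \<open>N\<close> rounds; the bound stays polynomial
  because the induction is over the fixed list of atoms. The restriction on \<open>writes k\<close>
  protects counters, variables and the list in register 14.\<close>

lemma tests_atoms_com:
  fixes k :: "('r, 'd) com"
  assumes "tests_com (V \<union> (\<Union>(R, xs) \<in> set as. set xs)) k H T" "poly_bounded T"
    and H: "\<And>A \<rho> \<rho>'. (\<forall>v \<in> V \<union> (\<Union>(R, xs) \<in> set as. set xs). \<rho> v = \<rho>' v) \<Longrightarrow> H A \<rho> = H A \<rho>'"
    and k: "writes k \<subseteq> {13, 18, 19, 20, 21}"
  shows "\<exists>T'. poly_bounded T' \<and> tests_com V (atoms_com V as k)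
     (\<lambda>A \<rho>. \<exists>\<rho>'. (\<forall>v \<in> V. \<rho>' v = \<rho> v) \<and> (\<forall>a \<in> set as. subst_atom \<rho>' a \<in> A) \<and> H A \<rho>') T'"
  using assms(1-3)
proof (induction as arbitrary: V)
  case Nil
  have "(\<exists>\<rho>'. (\<forall>v \<in> V. \<rho>' v = \<rho> v) \<and> H A \<rho>') = H A \<rho>" for A \<rho>
    using Nil.prems(3) by (metis (no_types, lifting) Un_empty_right UN_empty list.set(1))
  then show ?case using Nil.prems by auto
next
  case (Cons a as)
  obtain R xs where a: "a = (R, xs)" by fastforce
  let ?V = "V \<union> set xs" and ?k = "atoms_com (V \<union> set xs) as k"
  let ?H = "\<lambda>A \<rho>. \<exists>\<rho>'. (\<forall>v \<in> ?V. \<rho>' v = \<rho> v) \<and> (\<forall>a \<in> set as. subst_atom \<rho>' a \<in> A) \<and> H A \<rho>'"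
  have V: "V \<union> (\<Union>(R, xs) \<in> set (a # as). set xs) = ?V \<union> (\<Union>(R, xs) \<in> set as. set xs)"
    by (auto simp: a)
  obtain T where T: "poly_bounded T" "tests_com ?V ?k ?H T"
    using Cons.IH[of ?V] Cons.prems unfolding V by blast
  obtain U where U: "poly_bounded U" "\<And>N s \<rho> fs ts.
      s 14 = list_val (map fact_val fs) \<Longrightarrow> val_size (s 14) \<le> N \<Longrightarrow> vars_hold V s \<rho> N \<Longrightarrow>
      s 16 = list_val (map Const ts) \<Longrightarrow> val_size (s 16) \<le> N \<Longrightarrow>
      runs (match_com V xs ?k) s (U N) (\<lambda>s'. is_node (s' 13) \<longleftrightarrow> is_node (s 13) \<or>
       (\<exists>\<rho>'. (\<forall>v \<in> V. \<rho>' v = \<rho> v) \<and> map \<rho>' xs = ts \<and> ?H (set fs) \<rho>'))"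
    using runs_match_com[OF T(2,1)] by (smt (verit, ccfv_threshold))
  define body where "body = Seq (Left 17 15) (Seq (Load 18 (Rel R)) (If (Same 17 18)
       (Seq (Right 16 15) (match_com V xs ?k)) SKIP))"
  let ?it = "iter_reg (length as)"
  have wr: "writes body \<subseteq> {13, 15, 16, 17, 18, 19, 20, 21} \<union> iter_reg ` {..<length as} \<union>
      var_reg ` (- V)"
    using writes_match_com[of V xs ?k] writes_atoms_com[of ?V as k] k by (auto simp: body_def)
  \<comment> \<open>The operands compared here are relation names of size one, which
    \<open>N + 1\<close> covers.\<close>
  let ?B = "\<lambda>N. 1 + 1 + (1 + 1 + (1 + 2 * (N + 1) + ((1 + 1 + U N) + 0)))"
  let ?T = "\<lambda>N. N * (?B N + 7) + 4"
  have "runs (atoms_com V (a # as) k) s (?T N) (\<lambda>s'. is_node (s' 13) \<longleftrightarrow> is_node (s 13) \<or>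
      (\<exists>\<rho>'. (\<forall>v \<in> V. \<rho>' v = \<rho> v) \<and> (\<forall>a \<in> set (a # as). subst_atom \<rho>' a \<in> set fs) \<and> H (set fs) \<rho>'))"
    if s: "s 14 = list_val (map fact_val fs)" "val_size (s 14) \<le> N" "vars_hold V s \<rho> N"
    for N s \<rho> fs
  proof -
    \<comment> \<open>What a single fact contributes as the image of the first atom; the flag
      collects this over the facts visited.\<close>
    let ?P = "\<lambda>f. fst f = R \<and> (\<exists>\<rho>'. (\<forall>v \<in> V. \<rho>' v = \<rho> v) \<and> map \<rho>' xs = snd f \<and> ?H (set fs) \<rho>')"
    let ?I = "\<lambda>d v. is_node v \<longleftrightarrow> is_node (s 13) \<or> (\<exists>f \<in> set d. ?P f)"
    have size: "val_size (list_val (map fact_val fs) :: ('r, 'd) val) \<le> N" using s(1,2) by simp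
    have step: "runs body s' (?B N) (\<lambda>s'. ?I (d @ [f]) (s' 13))"
      if fs: "fs = d @ f # rest" and I: "?I d (s' 13)" and e: "s' 15 = fact_val f"
        and ag: "agree_except ({?it, 15} \<union> writes body) s s'" for d f rest s'
    proof -
      obtain R' ts where f: "f = (R', ts)" by fastforce
      let ?s = "s'(17 := Rel R', 18 := Rel R)"
      have eq: "s' i = s i" if "i \<notin> {?it, 15} \<union> writes body" for i
        using agree_exceptD[OF ag that] .
      have "14 \<notin> {?it, 15} \<union> writes body" using wr by auto
      then have s14: "s' 14 = list_val (map fact_val fs)" using eq s(1) by simp
      have "vars_hold V s' \<rho> N"
        by (rule vars_hold_agree[OF s(3) ag]) (use wr in auto)
      moreover have "val_size (fact_val f :: ('r, 'd) val) \<le> N"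
        using list_val_bounds(2)[OF size] fs by auto
      ultimately have m: "runs (match_com V xs ?k) (?s(16 := list_val (map Const ts))) (U N)
          (\<lambda>s''. is_node (s'' 13) \<longleftrightarrow> is_node (s' 13) \<or>
            (\<exists>\<rho>'. (\<forall>v \<in> V. \<rho>' v = \<rho> v) \<and> map \<rho>' xs = ts \<and> ?H (set fs) \<rho>'))"
        using U(2)[of "?s(16 := list_val (map Const ts))" fs N \<rho> ts] s14 size f by simp
      have "runs (If (Same 17 18) (Seq (Right 16 15) (match_com V xs ?k)) SKIP) ?s
          (1 + 2 * (N + 1) + ((1 + 1 + U N) + 0)) (\<lambda>s'. ?I (d @ [f]) (s' 13))"
      proof (rule runs_Same)
        assume "?s 17 = ?s 18"
        then have "R' = R" by simp
        then show "runs (Seq (Right 16 15) (match_com V xs ?k)) ?s (1 + 1 + U N)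
            (\<lambda>s'. ?I (d @ [f]) (s' 13))"
          by (intro runs_Seq runs_Right)
             (rule runs_conseq, use m e f in simp, use I f in auto)
      next
        assume "?s 17 \<noteq> ?s 18"
        then have "R' \<noteq> R" by simp
        then show "runs SKIP ?s 0 (\<lambda>s'. ?I (d @ [f]) (s' 13))"
          using I f by (intro runs_Skip) auto
      qed auto
      then show ?thesis unfolding body_def
        by (intro runs_Seq runs_Left runs_Load) (use e f in auto)
    qed
    have "runs (foreach 14 ?it 15 body) s (?T N) (\<lambda>s'. ?I fs (s' 13))"
      by (rule runs_foreach[where I = ?I and g = fact_val])
         (use step s(1) list_val_bounds(1)[OF size] wr in auto)
    \<comment> \<open>The loop yields one assignment from the match and one from the remaining
      atoms. They agree on \<open>V \<union> set xs\<close>, so the second serves for all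
      atoms.\<close>
    moreover have "(\<exists>f \<in> set fs. ?P f) \<longleftrightarrow> (\<exists>\<rho>'. (\<forall>v \<in> V. \<rho>' v = \<rho> v) \<and>
        (\<forall>a \<in> set (a # as). subst_atom \<rho>' a \<in> set fs) \<and> H (set fs) \<rho>')"
    proof
      assume "\<exists>f \<in> set fs. ?P f"
      then obtain ts \<rho>1 \<rho>2 where *: "(R, ts) \<in> set fs" "\<forall>v \<in> V. \<rho>1 v = \<rho> v" "map \<rho>1 xs = ts"
        "\<forall>v \<in> ?V. \<rho>2 v = \<rho>1 v" "\<forall>a \<in> set as. subst_atom \<rho>2 a \<in> set fs" "H (set fs) \<rho>2" by auto
      then have "map \<rho>2 xs = ts" by auto
      with * show "\<exists>\<rho>'. (\<forall>v \<in> V. \<rho>' v = \<rho> v) \<and>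
        (\<forall>a \<in> set (a # as). subst_atom \<rho>' a \<in> set fs) \<and> H (set fs) \<rho>'"
        by (intro exI[of _ \<rho>2]) (auto simp: a subst_atom_def)
    next
      assume "\<exists>\<rho>'. (\<forall>v \<in> V. \<rho>' v = \<rho> v) \<and>
        (\<forall>a \<in> set (a # as). subst_atom \<rho>' a \<in> set fs) \<and> H (set fs) \<rho>'"
      then obtain \<rho>' where *: "\<forall>v \<in> V. \<rho>' v = \<rho> v" "(R, map \<rho>' xs) \<in> set fs"
        "\<forall>a \<in> set as. subst_atom \<rho>' a \<in> set fs" "H (set fs) \<rho>'" by (auto simp: a subst_atom_def)
      have "?P (R, map \<rho>' xs)"
        using * by (auto intro!: exI[of _ \<rho>'])
      then show "\<exists>f \<in> set fs. ?P f" using *(2) by blast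
    qed
    ultimately show ?thesis by (simp add: a body_def)
  qed
  moreover have "poly_bounded ?T" by (intro poly_bounded_intros U)
  ultimately show ?case unfolding tests_com_def by blast
qed

definition denial_com :: "('r, 'd) denial \<Rightarrow> ('r, 'd) com" where
  "denial_com dc = atoms_com {} (body_atoms dc)
     (Seq (qf_com (condition dc)) (If (IsNode 21) (Load 13 yes_val) SKIP))"

fun denials_com :: "('r, 'd) denial list \<Rightarrow> ('r, 'd) com" where
  "denials_com [] = SKIP"
| "denials_com (dc # dcs) = Seq (denial_com dc) (denials_com dcs)"

lemma writes_denials_com: "writes (denials_com dcs) \<subseteq> {13} \<union> {15..}"
proof (induction dcs)
  case (Cons dc dcs)
  have "writes (denial_com dc) \<subseteq> {13} \<union> {15..}"
    using writes_atoms_com[of "{}" "body_atoms dc"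
        "Seq (qf_com (condition dc)) (If (IsNode 21) (Load 13 yes_val) SKIP)"]
      writes_qf_com[of "condition dc"]
    by (fastforce simp: denial_com_def var_reg_def iter_reg_def)
  then show ?case using Cons by simp
qed simp

text \<open>In a well-formed constraint every variable of the condition occurs in some atom, so all
  of them are bound when the innermost command evaluates the condition.\<close>

lemma tests_denial_com:
  fixes dc :: "('r, 'd) denial"
  assumes "wf_denial S dc"
  shows "\<exists>T. poly_bounded T \<and> tests_com {} (denial_com dc) (\<lambda>A \<rho>. \<not> satisfies A dc) T"
proof -
  let ?k = "Seq (qf_com (condition dc)) (If (IsNode 21) (Load 13 yes_val) SKIP) :: ('r, 'd) com"
  let ?W = "{} \<union> (\<Union>(R, xs) \<in> set (body_atoms dc). set xs)"
  have vars: "qf_vars (condition dc) \<subseteq> ?W" using assms by (auto simp: wf_denial_def)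
  obtain T where T: "poly_bounded T" "\<And>N (s :: ('r, 'd) store) \<rho>. vars_hold (qf_vars (condition dc)) s \<rho> N \<Longrightarrow>
     runs (qf_com (condition dc)) s (T N) (\<lambda>s'. is_node (s' 21) \<longleftrightarrow> holds \<rho> (condition dc))"
    using runs_qf_com[of "condition dc"] by blast
  let ?T = "\<lambda>N. T N + 1 + (1 + (1 + 0))"
  have "runs ?k s (?T N) (\<lambda>s'. is_node (s' 13) \<longleftrightarrow> is_node (s 13) \<or> holds \<rho> (condition dc))"
    if "vars_hold ?W s \<rho> N" for N \<rho> and s :: "('r, 'd) store"
  proof (rule runs_Seq_frame[OF T(2)])
    show "vars_hold (qf_vars (condition dc)) s \<rho> N" using that vars by (rule vars_hold_subset)
    fix s' assume s': "is_node (s' 21) \<longleftrightarrow> holds \<rho> (condition dc)"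
      "agree_except (writes (qf_com (condition dc))) s s'"
    have "s' 13 = s 13" by (rule agree_exceptD[OF s'(2)]) (use writes_qf_com in fastforce)
    then show "runs (If (IsNode 21) (Load 13 yes_val) SKIP) s' (1 + (1 + 0))
      (\<lambda>s'. is_node (s' 13) \<longleftrightarrow> is_node (s 13) \<or> holds \<rho> (condition dc))"
      by (intro runs_intros) (use s' in auto)
  qed
  then have "tests_com ?W ?k (\<lambda>A \<rho>. holds \<rho> (condition dc)) ?T"
    unfolding tests_com_def by blast
  moreover have "poly_bounded ?T" by (intro poly_bounded_intros T)
  \<comment> \<open>Truth of the condition depends only on its own variables; this discharges the
    hypothesis on \<open>H\<close> of the join.\<close>
  moreover have "holds \<rho> (condition dc) = holds \<rho>' (condition dc)"
    if "\<forall>v \<in> ?W. \<rho> v = \<rho>' v" for \<rho> \<rho>'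
  proof -
    have trm: "trm_val \<rho> t = trm_val \<rho>' t" if "\<forall>v \<in> trm_vars t. \<rho> v = \<rho>' v" for t
      using that by (cases t) auto
    have "holds \<rho> f = holds \<rho>' f" if "\<forall>v \<in> qf_vars f. \<rho> v = \<rho>' v" for f
      using that
    proof (induction f)
      case (Cmp p a b)
      then have "trm_val \<rho> a = trm_val \<rho>' a" "trm_val \<rho> b = trm_val \<rho>' b" by (auto intro: trm)
      then show ?case by simp
    qed auto
    then show ?thesis using that vars by blast
  qed
  moreover have "writes ?k \<subseteq> {13, 18, 19, 20, 21}"
    using writes_qf_com[of "condition dc"] by fastforce
  ultimately obtain T' where "poly_bounded T'" "tests_com {} (denial_com dc) (\<lambda>A \<rho>. \<exists>\<rho>'.
      (\<forall>v \<in> {}. \<rho>' v = \<rho> v) \<and> (\<forall>a \<in> set (body_atoms dc). subst_atom \<rho>' a \<in> A) \<and>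
      holds \<rho>' (condition dc)) T'"
    using tests_atoms_com[of "{}" "body_atoms dc" ?k "\<lambda>A \<rho>. holds \<rho> (condition dc)" ?T]
    unfolding denial_com_def by blast
  then show ?thesis by (auto simp: satisfies_def)
qed

lemma runs_denials_com:
  assumes "\<forall>dc \<in> set dcs. wf_denial S dc"
  shows "\<exists>T. poly_bounded T \<and> (\<forall>N s fs.
     s 14 = list_val (map fact_val fs) \<and> val_size (s 14) \<le> N \<longrightarrow>
     runs (denials_com dcs) s (T N) (\<lambda>s'. is_node (s' 13) \<longleftrightarrow>
       is_node (s 13) \<or> \<not> consistent (set dcs) (set fs)))"
  using assms
proof (induction dcs)
  case Nil
  show ?case
    by (rule exI[of _ "\<lambda>_. 0"])
       (auto simp: consistent_def intro!: runs_Skip poly_bounded_intros)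
next
  case (Cons dc dcs)
  obtain T where T: "poly_bounded T" "tests_com {} (denial_com dc) (\<lambda>A \<rho>. \<not> satisfies A dc) T"
    using tests_denial_com[of S dc] Cons.prems by auto
  obtain U where U: "poly_bounded U" "\<And>N s fs.
     s 14 = list_val (map fact_val fs) \<Longrightarrow> val_size (s 14) \<le> N \<Longrightarrow>
     runs (denials_com dcs) s (U N) (\<lambda>s'. is_node (s' 13) \<longleftrightarrow>
       is_node (s 13) \<or> \<not> consistent (set dcs) (set fs))"
    using Cons by auto
  let ?T = "\<lambda>N. T N + 1 + U N"
  have "runs (denials_com (dc # dcs)) s (?T N) (\<lambda>s'. is_node (s' 13) \<longleftrightarrow>
       is_node (s 13) \<or> \<not> consistent (set (dc # dcs)) (set fs))"
    if s: "s 14 = list_val (map fact_val fs)" "val_size (s 14) \<le> N" for N s fs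
    unfolding denials_com.simps
  proof (rule runs_Seq_frame)
    \<comment> \<open>No variable is bound at the start, so any assignment serves.\<close>
    show "runs (denial_com dc) s (T N) (\<lambda>s'. is_node (s' 13) \<longleftrightarrow>
        is_node (s 13) \<or> \<not> satisfies (set fs) dc)"
      by (rule tests_comD[OF T(2), where \<rho> = undefined]) (use s in \<open>auto simp: vars_hold_def\<close>)
    fix s' assume s': "is_node (s' 13) \<longleftrightarrow> is_node (s 13) \<or> \<not> satisfies (set fs) dc"
      "agree_except (writes (denial_com dc)) s s'"
    have "s' 14 = s 14"
      by (rule agree_exceptD[OF s'(2)]) (use writes_denials_com[of "[dc]"] in auto)
    then show "runs (denials_com dcs) s' (U N) (\<lambda>s'. is_node (s' 13) \<longleftrightarrow>
       is_node (s 13) \<or> \<not> consistent (set (dc # dcs)) (set fs))"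
      using s s'(1) by (intro runs_conseq[OF U(2)]) (auto simp: consistent_def)
  qed
  moreover have "poly_bounded ?T" by (intro poly_bounded_intros T U)
  ultimately show ?case by blast
qed

section \<open>An implementation of the algorithm\<close>

definition member_com :: "nat \<Rightarrow> nat \<Rightarrow> nat \<Rightarrow> nat \<Rightarrow> ('r, 'd) com" where
  "member_com r it e y = foreach r it e (If (Same e y) (Load 13 yes_val) SKIP)"

lemma runs_member_com:
  assumes "s r = list_val (map fact_val xs)" "s y = fact_val x"
    and "val_size (s r) \<le> N" "val_size (s y) \<le> N"
    and "it \<noteq> e" "it \<noteq> 13" "e \<noteq> 13" "y \<notin> {it, e, 13}"
  shows "runs (member_com r it e y) s (N * ((1 + 2 * N + (1 + 0)) + 7) + 4)
    (\<lambda>s'. is_node (s' 13) \<longleftrightarrow> is_node (s 13) \<or> x \<in> set xs)"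
  unfolding member_com_def
proof (rule runs_foreach[where I = "\<lambda>d v. is_node v \<longleftrightarrow> is_node (s 13) \<or> x \<in> set d"
      and g = fact_val])
  have size: "val_size (list_val (map fact_val xs) :: ('a, 'b) val) \<le> N" using assms by simp
  show "length xs \<le> N" using list_val_bounds(1)[OF size] .
  fix d z rest s'
  assume xs: "xs = d @ z # rest" and I: "is_node (s' 13) \<longleftrightarrow> is_node (s 13) \<or> x \<in> set d"
    and e: "s' e = fact_val z"
    and ag: "agree_except ({it, e} \<union> writes (If (Same e y) (Load 13 yes_val) SKIP)) s s'"
  have y: "s' y = fact_val x" using agree_exceptD[OF ag, of y] assms by simp
  have "val_size (fact_val z :: ('a, 'b) val) \<le> N" "val_size (fact_val x :: ('a, 'b) val) \<le> N"
    using list_val_bounds(2)[OF size, of z] xs assms(2,4) by auto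
  then show "runs (If (Same e y) (Load 13 yes_val) SKIP) s' (1 + 2 * N + (1 + 0))
      (\<lambda>s'. is_node (s' 13) \<longleftrightarrow> is_node (s 13) \<or> x \<in> set (d @ [z]))"
    by (intro runs_Same runs_intros) (use e y I in auto)
qed (use assms in auto)

text \<open>Membership is tested because only dominating facts still present count, while register 1
  keeps all pairs throughout the run. Register 10 holds first the lower, then the preferred fact of
  a pair.\<close>

definition dominated_com :: "('r, 'd) com" where
  "dominated_com = foreach 1 8 9 (Seq (Right 10 9)
     (If (Same 10 6) (Seq (Left 10 9) (member_com 0 11 12 10)) SKIP))"

lemma writes_dominated_com: "writes dominated_com = {8, 9, 10, 11, 12, 13}"
  by (auto simp: dominated_com_def member_com_def)

lemma runs_dominated_com:
  "\<exists>T. poly_bounded T \<and> (\<forall>N (s :: ('r, 'd) store) xs ps x.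
     s 0 = list_val (map fact_val xs) \<and> s 1 = list_val (map edge_val ps) \<and> s 6 = fact_val x \<and>
     x \<in> set xs \<and> val_size (s 0) \<le> N \<and> val_size (s 1) \<le> N \<longrightarrow>
     runs dominated_com s (T N) (\<lambda>s'. is_node (s' 13) \<longleftrightarrow>
       is_node (s 13) \<or> (\<exists>y \<in> set xs. (y, x) \<in> set ps)))"
proof -
  let ?B = "\<lambda>N. 1 + 1 + (1 + 2 * N + ((1 + 1 + (N * ((1 + 2 * N + (1 + 0)) + 7) + 4)) + 0))"
  let ?T = "\<lambda>N. N * (?B N + 7) + 4"
  have "runs dominated_com s (?T N) (\<lambda>s'. is_node (s' 13) \<longleftrightarrow>
       is_node (s 13) \<or> (\<exists>y \<in> set xs. (y, x) \<in> set ps))"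
    if s: "s 0 = list_val (map fact_val xs)" "s 1 = list_val (map edge_val ps)"
      "s 6 = fact_val x" "x \<in> set xs" "val_size (s 0) \<le> N" "val_size (s 1) \<le> N"
    for N xs ps x and s :: "('r, 'd) store"
    unfolding dominated_com_def
  proof (rule runs_foreach[where g = edge_val and
        I = "\<lambda>d v. is_node v \<longleftrightarrow> is_node (s 13) \<or> (\<exists>y \<in> set xs. (y, x) \<in> set d)"])
    have size0: "val_size (list_val (map fact_val xs) :: ('r, 'd) val) \<le> N"
      and size1: "val_size (list_val (map edge_val ps) :: ('r, 'd) val) \<le> N" using s by auto
    show "length ps \<le> N" using list_val_bounds(1)[OF size1] .
    fix d p rest s'
    assume ps: "ps = d @ p # rest"
      and I: "is_node (s' 13) \<longleftrightarrow> is_node (s 13) \<or> (\<exists>y \<in> set xs. (y, x) \<in> set d)"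
      and e: "s' 9 = edge_val p"
      and ag: "agree_except ({8, 9} \<union> writes (Seq (Right 10 9)
        (If (Same 10 6) (Seq (Left 10 9) (member_com 0 11 12 10)) SKIP))) s s'"
    obtain y z where p: "p = (y, z)" by (cases p)
    have eq: "s' 0 = s 0" "s' 6 = s 6" using ag by (auto simp: agree_except_def member_com_def)
    have "val_size (edge_val p :: ('r, 'd) val) \<le> N"
      using list_val_bounds(2)[OF size1, of p] ps by simp
    then have yz: "val_size (fact_val y :: ('r, 'd) val) \<le> N"
        "val_size (fact_val z :: ('r, 'd) val) \<le> N" by (simp_all add: p)
    have x: "val_size (fact_val x :: ('r, 'd) val) \<le> N"
      using list_val_bounds(2)[OF size0] s(4) by blast
    have mem: "runs (member_com 0 11 12 10) (s'(10 := fact_val y))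
       (N * ((1 + 2 * N + (1 + 0)) + 7) + 4)
       (\<lambda>s''. is_node (s'' 13) \<longleftrightarrow> is_node ((s'(10 := fact_val y)) 13) \<or> y \<in> set xs)"
      by (rule runs_member_com) (use s eq yz in auto)
    show "runs (Seq (Right 10 9) (If (Same 10 6) (Seq (Left 10 9) (member_com 0 11 12 10)) SKIP)) s'
      (?B N) (\<lambda>s'. is_node (s' 13) \<longleftrightarrow> is_node (s 13) \<or> (\<exists>y \<in> set xs. (y, x) \<in> set (d @ [p])))"
    proof (intro runs_Seq runs_Right runs_Same)
      assume "(s'(10 := right_of (s' 9))) 10 = (s'(10 := right_of (s' 9))) 6"
      then have "z = x" using e eq s by (simp add: p)
      then show "runs (Left 10 9) (s'(10 := right_of (s' 9))) 1
          (\<lambda>s'. runs (member_com 0 11 12 10) s' (N * ((1 + 2 * N + (1 + 0)) + 7) + 4)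
          (\<lambda>s'. is_node (s' 13) \<longleftrightarrow> is_node (s 13) \<or> (\<exists>y \<in> set xs. (y, x) \<in> set (d @ [p]))))"
        by (intro runs_Left) (rule runs_conseq, use mem e p in simp, use I p in auto)
    next
      assume "(s'(10 := right_of (s' 9))) 10 \<noteq> (s'(10 := right_of (s' 9))) 6"
      then have "z \<noteq> x" using e eq s by (simp add: p)
      then show "runs SKIP (s'(10 := right_of (s' 9))) 0
         (\<lambda>s'. is_node (s' 13) \<longleftrightarrow> is_node (s 13) \<or> (\<exists>y \<in> set xs. (y, x) \<in> set (d @ [p])))"
        by (intro runs_Skip) (use I p in auto)
    qed (use e p yz eq s x in auto)
  qed (use s in \<open>auto simp: member_com_def\<close>)
  moreover have "poly_bounded ?T" by (intro poly_bounded_intros)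
  ultimately show ?thesis by blast
qed

definition winnow_com :: "('r, 'd) com" where
  "winnow_com = Seq (Load 3 Leaf) (foreach 0 5 6 (Seq (Load 13 Leaf)
     (Seq dominated_com (If (IsNode 13) SKIP (MkNode 3 6 3)))))"

lemma writes_winnow_com: "writes winnow_com \<inter> {0, 1, 2, 4, 14} = {}"
  by (auto simp: winnow_com_def writes_dominated_com)

lemma runs_winnow_com:
  "\<exists>T. poly_bounded T \<and> (\<forall>N (s :: ('r, 'd) store) K P.
     encodes_set fact_val K (s 0) \<and> encodes_set edge_val P (s 1) \<and>
     val_size (s 0) \<le> N \<and> val_size (s 1) \<le> N \<longrightarrow>
     runs winnow_com s (T N) (\<lambda>s'. encodes_set fact_val (winnow P K) (s' 3)))"
proof -
  obtain T where T: "poly_bounded T" "\<And>N (s :: ('r, 'd) store) xs ps x.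
     s 0 = list_val (map fact_val xs) \<Longrightarrow> s 1 = list_val (map edge_val ps) \<Longrightarrow>
     s 6 = fact_val x \<Longrightarrow> x \<in> set xs \<Longrightarrow> val_size (s 0) \<le> N \<Longrightarrow> val_size (s 1) \<le> N \<Longrightarrow>
     runs dominated_com s (T N) (\<lambda>s'. is_node (s' 13) \<longleftrightarrow>
       is_node (s 13) \<or> (\<exists>y \<in> set xs. (y, x) \<in> set ps))"
    using runs_dominated_com by blast
  let ?B = "\<lambda>N. 1 + 1 + (T N + 1 + (1 + (0 + 1)))"
  let ?T = "\<lambda>N. 1 + 1 + (N * (?B N + 7) + 4)"
  have "runs winnow_com s (?T N) (\<lambda>s'. encodes_set fact_val (winnow P K) (s' 3))"
    if sets: "encodes_set fact_val K (s 0)" "encodes_set edge_val P (s 1)"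
      and size: "val_size (s 0) \<le> N" "val_size (s 1) \<le> N"
    for N K P and s :: "('r, 'd) store"
  proof -
    obtain xs ps where xs: "distinct xs" "set xs = K" "s 0 = list_val (map fact_val xs)"
      and ps: "set ps = P" "s 1 = list_val (map edge_val ps)"
      using sets unfolding encodes_set_def by auto
    let ?f = "\<lambda>x. \<not> (\<exists>y \<in> set xs. (y, x) \<in> set ps)"
    have len: "length xs \<le> N" using list_val_bounds(1)[of fact_val xs N] size(1) xs(3) by metis
    \<comment> \<open>Facts are prepended, hence \<open>rev\<close>; the order does not matter for
      \<open>encodes_set\<close>.\<close>
    have "runs winnow_com s (?T N)
        (\<lambda>s'. s' 3 = list_val (map fact_val (rev (filter ?f xs))))"
      unfolding winnow_com_def
    proof (rule runs_Seq, rule runs_Load, rule runs_foreach[where g = fact_val and N = N and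
          I = "\<lambda>d v. v = list_val (map fact_val (rev (filter ?f d)))"])
      fix d x "rest" s'
      assume d: "xs = d @ x # rest"
        and I: "s' 3 = list_val (map fact_val (rev (filter ?f d)))" and e: "s' 6 = fact_val x"
        and ag: "agree_except ({5, 6} \<union> writes (Seq (Load 13 Leaf)
          (Seq dominated_com (If (IsNode 13) SKIP (MkNode 3 6 3))))) (s(3 := Leaf)) s'"
      let ?s = "s'(13 := Leaf)"
      have eq: "s' 0 = s 0" "s' 1 = s 1"
        using ag by (auto simp: agree_except_def writes_dominated_com)
      have dom: "runs dominated_com ?s (T N) (\<lambda>s''. is_node (s'' 13) \<longleftrightarrow>
          is_node (?s 13) \<or> (\<exists>y \<in> set xs. (y, x) \<in> set ps))"
        by (rule T(2)) (use e eq xs ps size d in auto)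
      show "runs (Seq (Load 13 Leaf) (Seq dominated_com
          (If (IsNode 13) SKIP (MkNode 3 6 3)))) s' (?B N)
          (\<lambda>s'. s' 3 = list_val (map fact_val (rev (filter ?f (d @ [x])))))"
      proof (rule runs_Seq, rule runs_Load, rule runs_Seq_frame[OF dom])
        fix s'' assume s'': "is_node (s'' 13) \<longleftrightarrow>
          is_node (?s 13) \<or> (\<exists>y \<in> set xs. (y, x) \<in> set ps)"
          "agree_except (writes dominated_com) ?s s''"
        have "s'' 3 = s' 3" "s'' 6 = s' 6"
          using s''(2) by (auto simp: agree_except_def writes_dominated_com)
        then show "runs (If (IsNode 13) SKIP (MkNode 3 6 3)) s'' (1 + (0 + 1))
            (\<lambda>s'. s' 3 = list_val (map fact_val (rev (filter ?f (d @ [x])))))"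
          by (intro runs_intros) (use s''(1) I e in auto)
      qed
    qed (use xs len in \<open>auto simp: writes_dominated_com\<close>)
    then show ?thesis
    proof (rule runs_conseq)
      fix s' :: "('r, 'd) store" assume "s' 3 = list_val (map fact_val (rev (filter ?f xs)))"
      moreover have "set (rev (filter ?f xs)) = winnow P K" "distinct (rev (filter ?f xs))"
        using xs ps by (auto simp: winnow_def)
      ultimately show "encodes_set fact_val (winnow P K) (s' 3)" unfolding encodes_set_def by blast
    qed simp
  qed
  moreover have "poly_bounded ?T" by (intro poly_bounded_intros T)
  ultimately show ?thesis by blast
qed

section \<open>One iteration of the loop\<close>

definition remove_com :: "('r, 'd) com" where
  "remove_com = Seq (Load 7 Leaf)
     (Seq (foreach 0 5 6 (If (Same 6 4) SKIP (MkNode 7 6 7))) (Copy 0 7))"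

lemma writes_remove_com: "writes remove_com = {0, 5, 6, 7}"
  by (auto simp: remove_com_def)

lemma runs_remove_com:
  fixes s :: "('r, 'd) store"
  assumes K: "encodes_set fact_val K (s 0)" and x: "s 4 = fact_val x" "x \<in> K"
    and size: "val_size (s 0) \<le> N"
  shows "runs remove_com s (1 + 1 + (N * ((1 + 2 * N + (0 + 1)) + 7) + 4 + 1 + 1))
    (\<lambda>s'. encodes_set fact_val (K - {x}) (s' 0))"
proof -
  obtain xs where xs: "distinct xs" "set xs = K" "s 0 = list_val (map fact_val xs)"
    using K unfolding encodes_set_def by auto
  let ?f = "\<lambda>y. y \<noteq> x"
  have size': "val_size (list_val (map fact_val xs) :: ('r, 'd) val) \<le> N" using size xs by simp
  have "runs remove_com s (1 + 1 + (N * ((1 + 2 * N + (0 + 1)) + 7) + 4 + 1 + 1))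
      (\<lambda>s'. s' 0 = list_val (map fact_val (rev (filter ?f xs))))"
    unfolding remove_com_def
  proof (intro runs_Seq runs_Load,
      rule runs_conseq[OF runs_foreach[where g = fact_val and N = N and a = 7 and
        I = "\<lambda>d v. v = list_val (map fact_val (rev (filter ?f d)))"]])
    fix d y "rest" s'
    assume d: "xs = d @ y # rest"
      and I: "s' 7 = list_val (map fact_val (rev (filter ?f d)))" and e: "s' 6 = fact_val y"
      and ag: "agree_except ({5, 6} \<union> writes (If (Same 6 4) SKIP (MkNode 7 6 7))) (s(7 := Leaf)) s'"
    have "s' 4 = fact_val x" using ag x by (auto simp: agree_except_def)
    moreover have "val_size (fact_val x :: ('r, 'd) val) \<le> N"
      using list_val_bounds(2)[OF size', of x] x(2) xs(2) by simp
    moreover have "val_size (fact_val y :: ('r, 'd) val) \<le> N"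
      using list_val_bounds(2)[OF size', of y] d by simp
    ultimately show "runs (If (Same 6 4) SKIP (MkNode 7 6 7)) s' (1 + 2 * N + (0 + 1))
        (\<lambda>s'. s' 7 = list_val (map fact_val (rev (filter ?f (d @ [y])))))"
      by (intro runs_Same runs_intros) (use e I in auto)
  next
    fix s' :: "('r, 'd) store"
    assume "s' 7 = list_val (map fact_val (rev (filter ?f xs)))"
    then show "runs (Copy 0 7) s' 1 (\<lambda>s'. s' 0 = list_val (map fact_val (rev (filter ?f xs))))"
      by (intro runs_Copy) simp
  qed (use xs list_val_bounds(1)[OF size'] in auto)
  then show ?thesis
  proof (rule runs_conseq)
    fix s' :: "('r, 'd) store" assume "s' 0 = list_val (map fact_val (rev (filter ?f xs)))"
    moreover have "set (rev (filter ?f xs)) = K - {x}" "distinct (rev (filter ?f xs))"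
      using xs by auto
    ultimately show "encodes_set fact_val (K - {x}) (s' 0)" unfolding encodes_set_def by blast
  qed simp
qed

text \<open>Register 14 receives \<open>J\<close> with the chosen fact prepended. It is both the
  list tested for consistency and the new value of \<open>J\<close>, so acceptance is a single
  copy.\<close>

definition update_com :: "('r, 'd) denial list \<Rightarrow> ('r, 'd) com" where
  "update_com dcs = Seq remove_com (Seq (MkNode 14 4 2) (Seq (Load 13 Leaf)
     (Seq (denials_com dcs) (Seq (If (IsNode 13) SKIP (Copy 2 14)) winnow_com))))"

text \<open>A bound independent of the state: the remaining facts, the kept ones and the winnow set
  are always subsets of \<open>I\<close>, so one \<open>N\<close> serves for a whole run.\<close>

definition size_bound :: "('r, 'd) fact set \<Rightarrow> ('r, 'd) preference \<Rightarrow> nat \<Rightarrow> bool" where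
  "size_bound I P N \<longleftrightarrow>
     (\<forall>K (v :: ('r, 'd) val). K \<subseteq> I \<and> encodes_set fact_val K v \<longrightarrow> val_size v \<le> N) \<and>
     (\<forall>v :: ('r, 'd) val. encodes_set edge_val P v \<longrightarrow> val_size v \<le> N)"

lemma size_boundD:
  "size_bound I P N \<Longrightarrow> encodes_set fact_val K v \<Longrightarrow> K \<subseteq> I \<Longrightarrow> val_size v \<le> N"
  "size_bound I P N \<Longrightarrow> encodes_set edge_val P v \<Longrightarrow> val_size v \<le> N"
  unfolding size_bound_def by blast+

lemma size_bound_input: "input_store I P s \<Longrightarrow> size_bound I P (input_size s)"
  unfolding size_bound_def input_store_def input_size_def
  by (meson encodes_set_size_mono order_refl trans_le_add1 trans_le_add2)

text \<open>Correctness of the loop body is required for every store representing a reachable state,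
  without an input store at hand; this provides some bound there.\<close>

lemma size_bound_exists:
  fixes I :: "('r, 'd) fact set"
  assumes "finite I" "finite P" shows "\<exists>N. size_bound I P N"
proof -
  obtain xs ps where "distinct xs" "set xs = I" "distinct ps" "set ps = P"
    using assms finite_distinct_list by metis
  then have "encodes_set fact_val I (list_val (map fact_val xs) :: ('r, 'd) val)"
    "encodes_set edge_val P (list_val (map edge_val ps) :: ('r, 'd) val)"
    unfolding encodes_set_def by blast+
  then have "input_store I P
      (\<lambda>i. if i = 0 then list_val (map fact_val xs) else if i = 1 then list_val (map edge_val ps) else Leaf)"
    by (simp add: input_store_def)
  then show ?thesis using size_bound_input by blast
qed

lemma runs_update_com:
  assumes "\<forall>dc \<in> set dcs. wf_denial S dc"
  shows "\<exists>T. poly_bounded T \<and> (\<forall>N (s :: ('r, 'd) store) I P Io J x.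
     represents P (Io, J) s \<and> s 4 = fact_val x \<and> x \<in> Io \<and> Io \<subseteq> I \<and> J \<subseteq> I - Io \<and>
     size_bound I P N \<longrightarrow>
     runs (update_com dcs) s (T N) (represents P
       (Io - {x}, if consistent (set dcs) (J \<union> {x}) then J \<union> {x} else J)))"
proof -
  obtain T where T: "poly_bounded T" "\<And>N (s :: ('r, 'd) store) fs.
     s 14 = list_val (map fact_val fs) \<Longrightarrow> val_size (s 14) \<le> N \<Longrightarrow>
     runs (denials_com dcs) s (T N) (\<lambda>s'. is_node (s' 13) \<longleftrightarrow>
       is_node (s 13) \<or> \<not> consistent (set dcs) (set fs))"
    using runs_denials_com[OF assms] by blast
  obtain U where U: "poly_bounded U" "\<And>N (s :: ('r, 'd) store) K P.
     encodes_set fact_val K (s 0) \<Longrightarrow> encodes_set edge_val P (s 1) \<Longrightarrow>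
     val_size (s 0) \<le> N \<Longrightarrow> val_size (s 1) \<le> N \<Longrightarrow>
     runs winnow_com s (U N) (\<lambda>s'. encodes_set fact_val (winnow P K) (s' 3))"
    using runs_winnow_com by blast
  let ?T = "\<lambda>N. 1 + 1 + (N * ((1 + 2 * N + (0 + 1)) + 7) + 4 + 1 + 1) + 1 +
    (1 + 1 + (1 + 1 + (T N + 1 + (1 + (0 + 1) + 1 + U N))))"
  have "runs (update_com dcs) s (?T N) (represents P
       (Io - {x}, if consistent (set dcs) (J \<union> {x}) then J \<union> {x} else J))" (is "runs _ _ _ ?Q")
    if rep: "represents P (Io, J) s" and x: "s 4 = fact_val x" "x \<in> Io"
      and sub: "Io \<subseteq> I" "J \<subseteq> I - Io" and bound: "size_bound I P N"
    for N I P Io J x and s :: "('r, 'd) store"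
    unfolding update_com_def
  proof (rule runs_Seq_frame[OF runs_remove_com])
    have Io: "encodes_set fact_val Io (s 0)" and P: "encodes_set edge_val P (s 1)"
      and J: "encodes_set fact_val J (s 2)" using rep by auto
    have Psize: "val_size (s 1) \<le> N" using size_boundD(2)[OF bound P] .
    show "encodes_set fact_val Io (s 0)" "s 4 = fact_val x" "x \<in> Io" by fact+
    show "val_size (s 0) \<le> N" using size_boundD(1)[OF bound Io sub(1)] .
    obtain js where js: "distinct js" "set js = J" "s 2 = list_val (map fact_val js)"
      using J unfolding encodes_set_def by auto
    fix s1 assume Io1: "encodes_set fact_val (Io - {x}) (s1 0)"
      and ag1: "agree_except (writes remove_com) s s1"
    have s1: "s1 1 = s 1" "s1 2 = s 2" "s1 4 = s 4"
      using ag1 by (auto simp: agree_except_def writes_remove_com)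
    let ?s = "s1(14 := Node (s1 4) (s1 2), 13 := Leaf)"
    have s14: "?s 14 = list_val (map fact_val (x # js))" using s1 js x by simp
    \<comment> \<open>\<open>J\<close> contains only removed facts, so \<open>x\<close> is
      new.\<close>
    have "distinct (x # js)" "set (x # js) = J \<union> {x}" using js x sub by auto
    then have enc14: "encodes_set fact_val (J \<union> {x}) (?s 14)"
      unfolding encodes_set_def using s14 by blast
    have "J \<union> {x} \<subseteq> I" using sub x by auto
    with enc14 have size14: "val_size (?s 14) \<le> N" using size_boundD(1)[OF bound] by blast
    have den: "runs (denials_com dcs) ?s (T N) (\<lambda>s'. is_node (s' 13) \<longleftrightarrow>
       is_node (?s 13) \<or> \<not> consistent (set dcs) (set (x # js)))"
      by (rule T(2)) (rule s14, rule size14)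
    show "runs (Seq (MkNode 14 4 2) (Seq (Load 13 Leaf) (Seq (denials_com dcs)
        (Seq (If (IsNode 13) SKIP (Copy 2 14)) winnow_com)))) s1
        (1 + 1 + (1 + 1 + (T N + 1 + (1 + (0 + 1) + 1 + U N)))) ?Q"
    proof (rule runs_Seq, rule runs_MkNode, rule runs_Seq, rule runs_Load,
        rule runs_Seq_frame[OF den])
      fix s3 assume "is_node (s3 13) \<longleftrightarrow>
        is_node (?s 13) \<or> \<not> consistent (set dcs) (set (x # js))"
        and ag3: "agree_except (writes (denials_com dcs)) ?s s3"
      then have s13: "is_node (s3 13) \<longleftrightarrow> \<not> consistent (set dcs) (J \<union> {x})" using js by simp
      have s3: "s3 i = ?s i" if "i \<in> {0, 1, 2, 14}" for i
        using agree_exceptD[OF agree_except_mono[OF ag3 writes_denials_com], of i] that by auto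
      let ?J = "if consistent (set dcs) (J \<union> {x}) then J \<union> {x} else J"
      have win: "runs winnow_com s4 (U N) ?Q"
        if s4: "s4 0 = s1 0" "s4 1 = s 1" "encodes_set fact_val ?J (s4 2)" for s4
      proof -
        have "Io - {x} \<subseteq> I" using sub by auto
        then have "val_size (s4 0) \<le> N" using s4(1) size_boundD(1)[OF bound Io1] by simp
        then have "runs winnow_com s4 (U N)
            (\<lambda>s'. encodes_set fact_val (winnow P (Io - {x})) (s' 3))"
          using U(2) Io1 P Psize s4 by auto
        from runs_frame[OF this] show ?thesis
        proof (rule runs_conseq)
          fix s5 assume s5: "encodes_set fact_val (winnow P (Io - {x})) (s5 3) \<and>
            agree_except (writes winnow_com) s4 s5"
          have "s5 i = s4 i" if "i \<in> {0, 1, 2}" for i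
            by (rule agree_exceptD[OF conjunct2[OF s5]]) (use that writes_winnow_com in auto)
          then show "?Q s5" using s5 s4 Io1 P by simp
        qed simp
      qed
      show "runs (Seq (If (IsNode 13) SKIP (Copy 2 14)) winnow_com) s3 (1 + (0 + 1) + 1 + U N) ?Q"
        by (rule runs_Seq, rule runs_IsNode; intro runs_intros win)
           (use s13 s3 s1 J enc14 in auto)
    qed
  qed
  moreover have "poly_bounded ?T" by (intro poly_bounded_intros T U)
  ultimately show ?thesis by blast
qed

text \<open>Loading the head first guarantees a fact in register 4 even if every choice skips; each
  later choice may replace it by the current element.\<close>

definition choose_com :: "('r, 'd) com" where
  "choose_com = Seq (Left 4 3) (foreach 3 5 6 (Choice (Copy 4 6) SKIP))"

lemma writes_choose_com: "writes choose_com = {4, 5, 6}"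
  by (auto simp: choose_com_def)

lemma runs_choose_com:
  fixes s :: "('r, 'd) store"
  assumes K: "encodes_set fact_val K (s 3)" "K \<noteq> {}" and size: "val_size (s 3) \<le> N"
  shows "runs choose_com s (1 + 1 + (N * ((1 + (1 + 0)) + 7) + 4)) (\<lambda>s'. \<exists>x \<in> K. s' 4 = fact_val x)"
proof -
  obtain xs where xs: "set xs = K" "s 3 = list_val (map fact_val xs)"
    using K unfolding encodes_set_def by auto
  then obtain x ys where x: "xs = x # ys" using K(2) by (cases xs) auto
  have size': "val_size (list_val (map fact_val xs) :: ('r, 'd) val) \<le> N" using size xs by simp
  show ?thesis
    unfolding choose_com_def
  proof (intro runs_Seq runs_Left runs_foreach[where g = fact_val and N = N and xs = xs and
        I = "\<lambda>d v. \<exists>x \<in> K. v = fact_val x"])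
    fix d y "rest" and s' :: "('r, 'd) store"
    assume "xs = d @ y # rest" "\<exists>x \<in> K. s' 4 = fact_val x" "s' 6 = fact_val y"
    then show "runs (Choice (Copy 4 6) SKIP) s' (1 + (1 + 0)) (\<lambda>s'. \<exists>x \<in> K. s' 4 = fact_val x)"
      by (intro runs_intros) (use xs in auto)
  qed (use xs x list_val_bounds(1)[OF size'] in auto)
qed

text \<open>The prescribed value is either already in register 4 or still to come: copy when the
  current element equals it, otherwise skip.\<close>

lemma exec_choose_scan:
  assumes "s 5 = list_val vs" "v = s 4 \<or> v \<in> set vs"
  shows "\<exists>s'. exec (scan 5 6 (Choice (Copy 4 6) SKIP)) s s' \<and> s' 4 = v"
  using assms
proof (induction vs arbitrary: s)
  case Nil
  then show ?case unfolding scan_def by (auto intro!: exec_While_stop exI[of _ s])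
next
  case (Cons u vs)
  let ?s = "s(6 := u, 5 := list_val vs)"
  have "exec (Left 6 5) s (s(6 := u))" "exec (Right 5 5) (s(6 := u)) ?s"
    using exec_first[OF mstep.Left[of 6 5 s] exec_Skip]
      exec_first[OF mstep.Right[of 5 5 "s(6 := u)"] exec_Skip] Cons.prems(1) by auto
  then have body: "exec (Seq (Left 6 5) (Seq (Right 5 5) c)) s s'" if "exec c ?s s'" for c s'
    using that by (blast intro: exec_Seq)
  have skip: "exec (Choice (Copy 4 6) SKIP) ?s ?s"
    by (rule exec_first[OF mstep.Choice2 exec_Skip])
  have copy: "exec (Choice (Copy 4 6) SKIP) ?s (?s(4 := u))"
  proof -
    have "exec (Copy 4 6) ?s (?s(4 := ?s 6))" by (rule exec_first[OF mstep.Copy exec_Skip])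
    then have "exec (Choice (Copy 4 6) SKIP) ?s (?s(4 := ?s 6))"
      by (rule exec_first[OF mstep.Choice1])
    then show ?thesis by simp
  qed
  have loop: "exec (scan 5 6 (Choice (Copy 4 6) SKIP)) s s''"
    if "exec (Choice (Copy 4 6) SKIP) ?s s'" "exec (scan 5 6 (Choice (Copy 4 6) SKIP)) s' s''"
    for s' s''
    using exec_While_step[OF _ body[OF that(1)] that(2)[unfolded scan_def]] Cons.prems(1)
    by (simp add: scan_def)
  show ?case
  proof (cases "v = u")
    case True
    then have "\<exists>s'. exec (scan 5 6 (Choice (Copy 4 6) SKIP)) (?s(4 := u)) s' \<and> s' 4 = v"
      by (intro Cons.IH) auto
    then show ?thesis using loop[OF copy] by blast
  next
    case False
    then have "\<exists>s'. exec (scan 5 6 (Choice (Copy 4 6) SKIP)) ?s s' \<and> s' 4 = v"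
      using Cons.prems by (intro Cons.IH) auto
    then show ?thesis using loop[OF skip] by blast
  qed
qed

lemma exec_agree: "exec c s s' \<Longrightarrow> agree_except (writes c) s s'"
  unfolding exec_def using msteps_writes by blast

lemma exec_choose_com:
  assumes "encodes_set fact_val K (s 3)" "x \<in> K"
  shows "\<exists>s'. exec choose_com s s' \<and> s' 4 = fact_val x"
proof -
  obtain xs where xs: "set xs = K" "s 3 = list_val (map fact_val xs)"
    using assms unfolding encodes_set_def by auto
  let ?s = "s(4 := left_of (s 3))"
  obtain s' where "exec (scan 5 6 (Choice (Copy 4 6) SKIP)) (?s(5 := ?s 3)) s'" "s' 4 = fact_val x"
    using exec_choose_scan[of "?s(5 := ?s 3)" "map fact_val xs" "fact_val x"] xs assms(2) by auto
  then show ?thesis unfolding choose_com_def foreach_def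
    by (meson exec_Seq exec_first exec_Skip mstep.Left mstep.Copy)
qed

definition body_com :: "('r, 'd) denial list \<Rightarrow> ('r, 'd) com" where
  "body_com dcs = Seq choose_com (update_com dcs)"

lemma represents_after_choose:
  "represents P \<sigma> s \<Longrightarrow> agree_except (writes choose_com) s s' \<Longrightarrow> represents P \<sigma> s'"
  by (cases \<sigma>) (simp add: agree_except_def writes_choose_com)

text \<open>The choice is the only real nondeterminism: once the fact is fixed, every run of
  \<open>update_com\<close> represents the same successor state. So the second half prescribes the
  choice and takes any halting run of the rest.\<close>

lemma body_com_correct:
  assumes "\<forall>dc \<in> set dcs. wf_denial S dc"
  shows "\<exists>T. poly_bounded T \<and> (\<forall>N (s :: ('r, 'd) store) I P \<sigma>.
     (alg_step (set dcs) P)\<^sup>*\<^sup>* (I, {}) \<sigma> \<and> represents P \<sigma> s \<and> size_bound I P N \<longrightarrow>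
     (winnow P (fst \<sigma>) \<noteq> {} \<longrightarrow> runs (body_com dcs) s (T N)
        (\<lambda>s'. \<exists>\<sigma>'. alg_step (set dcs) P \<sigma> \<sigma>' \<and> represents P \<sigma>' s')) \<and>
     (\<forall>\<sigma>'. alg_step (set dcs) P \<sigma> \<sigma>' \<longrightarrow> (\<exists>s'. exec (body_com dcs) s s' \<and> represents P \<sigma>' s')))"
proof -
  obtain T where T: "poly_bounded T" "\<And>N (s :: ('r, 'd) store) I P Io J x.
     represents P (Io, J) s \<Longrightarrow> s 4 = fact_val x \<Longrightarrow> x \<in> Io \<Longrightarrow> Io \<subseteq> I \<Longrightarrow> J \<subseteq> I - Io \<Longrightarrow>
     size_bound I P N \<Longrightarrow>
     runs (update_com dcs) s (T N) (represents P
       (Io - {x}, if consistent (set dcs) (J \<union> {x}) then J \<union> {x} else J))"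
    using runs_update_com[OF assms] by blast
  let ?T = "\<lambda>N. 1 + 1 + (N * ((1 + (1 + 0)) + 7) + 4) + 1 + T N"
  have "(winnow P (fst \<sigma>) \<noteq> {} \<longrightarrow> runs (body_com dcs) s (?T N)
        (\<lambda>s'. \<exists>\<sigma>'. alg_step (set dcs) P \<sigma> \<sigma>' \<and> represents P \<sigma>' s')) \<and>
     (\<forall>\<sigma>'. alg_step (set dcs) P \<sigma> \<sigma>' \<longrightarrow> (\<exists>s'. exec (body_com dcs) s s' \<and> represents P \<sigma>' s'))"
    if run: "(alg_step (set dcs) P)\<^sup>*\<^sup>* (I, {}) \<sigma>" and rep: "represents P \<sigma> s"
      and bound: "size_bound I P N" for N I P \<sigma> and s :: "('r, 'd) store"
  proof -
    obtain Io J where \<sigma>: "\<sigma> = (Io, J)" by fastforce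
    have sub: "Io \<subseteq> I" "J \<subseteq> I - Io" using alg_run_subset[OF run] by (auto simp: \<sigma>)
    have W: "encodes_set fact_val (winnow P Io) (s 3)" using rep by (simp add: \<sigma>)
    have WIo: "winnow P Io \<subseteq> Io" by (auto simp: winnow_def)
    then have "winnow P Io \<subseteq> I" using sub by auto
    then have size: "val_size (s 3) \<le> N" by (rule size_boundD(1)[OF bound W])
    have upd: "runs (update_com dcs) s' (T N) (represents P
        (Io - {x}, if consistent (set dcs) (J \<union> {x}) then J \<union> {x} else J))"
      if "x \<in> winnow P Io" "s' 4 = fact_val x" "agree_except (writes choose_com) s s'" for x s'
    proof (rule T(2))
      show "represents P (Io, J) s'" using represents_after_choose[OF rep that(3)] unfolding \<sigma> .
      show "x \<in> Io" using that(1) WIo by blast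
    qed (fact that(2) sub bound)+
    have "runs (body_com dcs) s (?T N)
        (\<lambda>s'. \<exists>\<sigma>'. alg_step (set dcs) P \<sigma> \<sigma>' \<and> represents P \<sigma>' s')"
      if "winnow P Io \<noteq> {}"
      unfolding body_com_def
    proof (rule runs_Seq_frame, rule runs_choose_com)
      show "encodes_set fact_val (winnow P Io) (s 3)" "winnow P Io \<noteq> {}" "val_size (s 3) \<le> N"
        by (fact W that size)+
      fix s' :: "('r, 'd) store"
      assume ex: "\<exists>x \<in> winnow P Io. s' 4 = fact_val x"
        and ag: "agree_except (writes choose_com) s s'"
      from ex obtain x where x: "x \<in> winnow P Io" "s' 4 = fact_val x" ..
      show "runs (update_com dcs) s' (T N)
          (\<lambda>s'. \<exists>\<sigma>'. alg_step (set dcs) P \<sigma> \<sigma>' \<and> represents P \<sigma>' s')"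
      proof (rule runs_conseq)
        show "runs (update_com dcs) s' (T N) (represents P
            (Io - {x}, if consistent (set dcs) (J \<union> {x}) then J \<union> {x} else J))"
          by (rule upd) (fact x ag)+
        have "alg_step (set dcs) P \<sigma>
            (Io - {x}, if consistent (set dcs) (J \<union> {x}) then J \<union> {x} else J)"
          unfolding \<sigma> by (rule alg_step.intros[OF x(1)])
        then show "\<exists>\<sigma>'. alg_step (set dcs) P \<sigma> \<sigma>' \<and> represents P \<sigma>' s''"
          if "represents P (Io - {x}, if consistent (set dcs) (J \<union> {x}) then J \<union> {x} else J) s''"
          for s'' using that by blast
      qed simp
    qed
    moreover have "\<exists>s'. exec (body_com dcs) s s' \<and> represents P \<sigma>' s'"
      if st: "alg_step (set dcs) P \<sigma> \<sigma>'" for \<sigma>'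
    proof -
      obtain x where x: "x \<in> winnow P Io"
        and \<sigma>': "\<sigma>' = (Io - {x}, if consistent (set dcs) (J \<union> {x}) then J \<union> {x} else J)"
        using st unfolding \<sigma> by (auto elim: alg_step.cases)
      obtain s1 where s1: "exec choose_com s s1" "s1 4 = fact_val x"
        using exec_choose_com[where s = s, OF W x] by blast
      have "runs (update_com dcs) s1 (T N) (represents P \<sigma>')"
        unfolding \<sigma>' by (rule upd) (fact x s1(2) exec_agree[OF s1(1)])+
      then obtain s2 where "exec (update_com dcs) s1 s2" "represents P \<sigma>' s2"
        using runs_exec by blast
      then show ?thesis using exec_Seq[OF s1(1)] unfolding body_com_def by blast
    qed
    ultimately show ?thesis by (simp add: \<sigma>)
  qed
  moreover have "poly_bounded ?T" by (intro poly_bounded_intros T)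
  ultimately show ?thesis by blast
qed

section \<open>The complete program\<close>

definition init_com :: "('r, 'd) com" where
  "init_com = Seq (Load 2 Leaf) winnow_com"

lemma runs_init_com:
  "\<exists>T. poly_bounded T \<and> (\<forall>(s :: ('r, 'd) store) I P. input_store I P s \<longrightarrow>
     runs init_com s (T (input_size s)) (represents P (I, {})))"
proof -
  obtain U where U: "poly_bounded U" "\<And>N (s :: ('r, 'd) store) K P.
     encodes_set fact_val K (s 0) \<Longrightarrow> encodes_set edge_val P (s 1) \<Longrightarrow>
     val_size (s 0) \<le> N \<Longrightarrow> val_size (s 1) \<le> N \<Longrightarrow>
     runs winnow_com s (U N) (\<lambda>s'. encodes_set fact_val (winnow P K) (s' 3))"
    using runs_winnow_com by blast
  let ?T = "\<lambda>N. 1 + 1 + U N"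
  have "runs init_com s (?T (input_size s)) (represents P (I, {}))"
    if s: "input_store I P s" for I P and s :: "('r, 'd) store"
    unfolding init_com_def
  proof (intro runs_Seq runs_Load)
    have enc: "encodes_set fact_val I (s 0)" "encodes_set edge_val P (s 1)"
      using s by (auto simp: input_store_def)
    have "runs winnow_com (s(2 := Leaf)) (U (input_size s))
        (\<lambda>s'. encodes_set fact_val (winnow P I) (s' 3))"
      by (rule U(2)) (use enc in \<open>auto simp: input_size_def\<close>)
    from runs_frame[OF this]
    show "runs winnow_com (s(2 := Leaf)) (U (input_size s)) (represents P (I, {}))"
    proof (rule runs_conseq)
      fix s' assume s': "encodes_set fact_val (winnow P I) (s' 3) \<and>
        agree_except (writes winnow_com) (s(2 := Leaf)) s'"
      have "s' i = (s(2 := Leaf)) i" if "i \<in> {0, 1, 2}" for i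
        by (rule agree_exceptD[OF conjunct2[OF s']]) (use that writes_winnow_com in auto)
      then show "represents P (I, {}) s'" using s' enc by (simp add: encodes_set_def)
    qed simp
  qed
  moreover have "poly_bounded ?T" by (intro poly_bounded_intros U)
  ultimately show ?thesis by blast
qed

text \<open>Each iteration removes a fact, so the number of remaining facts bounds the number of
  iterations. The \<open>3\<close> beyond \<open>B\<close> pays for unfolding, test and
  sequencing.\<close>

lemma runs_main_loop:
  assumes body: "\<And>\<sigma> s. (alg_step F P)\<^sup>*\<^sup>* (I, {}) \<sigma> \<Longrightarrow> represents P \<sigma> s \<Longrightarrow>
      winnow P (fst \<sigma>) \<noteq> {} \<Longrightarrow>
      runs body s B (\<lambda>s'. \<exists>\<sigma>'. alg_step F P \<sigma> \<sigma>' \<and> represents P \<sigma>' s')"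
    and "finite I" "(alg_step F P)\<^sup>*\<^sup>* (I, {}) \<sigma>" "represents P \<sigma> s" "card (fst \<sigma>) \<le> n"
  shows "runs (While (IsNode 3) body) s (n * (B + 3) + 2)
    (\<lambda>s'. \<exists>J. alg_returns F I P J \<and> encodes_set fact_val J (s' 2))"
  using assms(3-5)
proof (induction n arbitrary: \<sigma> s)
  let ?Q = "\<lambda>s'. \<exists>J. alg_returns F I P J \<and> encodes_set fact_val J (s' 2)"
  have node: "is_node (s 3) \<longleftrightarrow> winnow P (fst \<sigma>) \<noteq> {}" if "represents P \<sigma> s" for \<sigma> s
    using that by (cases \<sigma>) (auto simp: encodes_set_is_node)
  have stop: "runs (While (IsNode 3) body) s (1 + (1 + 0)) ?Q"
    if "(alg_step F P)\<^sup>*\<^sup>* (I, {}) \<sigma>" "represents P \<sigma> s" "winnow P (fst \<sigma>) = {}" for \<sigma> s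
  proof (intro runs_While runs_If_bound runs_Skip)
    assume "test_holds (IsNode 3) s"
    then show "runs (Seq body (While (IsNode 3) body)) s 0 ?Q"
      using node[OF that(2)] that(3) by (simp add: test_IsNode del: test_holds.simps)
  next
    show "?Q s" using that by (cases \<sigma>) (auto simp: alg_returns_def)
  qed simp
  {
    case 0
    have "finite (fst \<sigma>)"
      using alg_run_subset[OF 0(1)] assms(2) finite_subset by blast
    then have "winnow P (fst \<sigma>) = {}" using 0(3) by (auto simp: winnow_def)
    then show ?case using stop[OF 0(1,2)] by simp
  next
    case (Suc n)
    have fin: "finite (fst \<sigma>)"
      using alg_run_subset[OF Suc.prems(1)] assms(2) finite_subset by blast
    show ?case
    proof (cases "winnow P (fst \<sigma>) = {}")
      case True
      then show ?thesis using stop[OF Suc.prems(1,2)] by (auto intro: runs_mono)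
    next
      case False
      have "runs (Seq body (While (IsNode 3) body)) s (B + 1 + (n * (B + 3) + 2)) ?Q"
      proof (rule runs_Seq_frame[OF body[OF Suc.prems(1,2) False]])
        fix s' assume "\<exists>\<sigma>'. alg_step F P \<sigma> \<sigma>' \<and> represents P \<sigma>' s'"
        then obtain \<sigma>' where \<sigma>': "alg_step F P \<sigma> \<sigma>'" "represents P \<sigma>' s'" by blast
        show "runs (While (IsNode 3) body) s' (n * (B + 3) + 2) ?Q"
        proof (rule Suc.IH)
          show "(alg_step F P)\<^sup>*\<^sup>* (I, {}) \<sigma>'" using Suc.prems(1) \<sigma>'(1) by simp
          show "card (fst \<sigma>') \<le> n" using alg_step_card[OF \<sigma>'(1) fin] Suc.prems(3) by simp
        qed (fact \<sigma>'(2))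
      qed
      then have "runs (While (IsNode 3) body) s (1 + (1 + (B + 1 + (n * (B + 3) + 2)))) ?Q"
        by (intro runs_While runs_If_bound)
           (use node[OF Suc.prems(2)] False in \<open>simp_all add: test_IsNode del: test_holds.simps\<close>)
      then show ?thesis by (rule runs_mono) simp
    qed
  }
qed

text \<open>Follows a given run from its current state onwards, matching each step by one execution
  of the body; reachability from the start is carried along because the body is only specified
  there.\<close>

lemma exec_main_loop:
  assumes body: "\<And>\<sigma> \<sigma>' s. (alg_step F P)\<^sup>*\<^sup>* (I, {}) \<sigma> \<Longrightarrow> represents P \<sigma> s \<Longrightarrow>
      alg_step F P \<sigma> \<sigma>' \<Longrightarrow> \<exists>s'. exec body s s' \<and> represents P \<sigma>' s'"
    and "(alg_step F P)\<^sup>*\<^sup>* \<sigma> (Io, J)" "winnow P Io = {}"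
    and "(alg_step F P)\<^sup>*\<^sup>* (I, {}) \<sigma>" "represents P \<sigma> s"
  shows "\<exists>s'. exec (While (IsNode 3) body) s s' \<and> encodes_set fact_val J (s' 2)"
  using assms(2,4,5)
proof (induction arbitrary: s rule: converse_rtranclp_induct)
  case base
  then have "\<not> is_node (s 3)"
    using assms(3) encodes_set_is_node[of fact_val "{}" "s 3"] by auto
  then show ?case using exec_While_stop base by fastforce
next
  case (step \<sigma> \<sigma>')
  obtain s' where s': "exec body s s'" "represents P \<sigma>' s'"
    using body[OF step.prems(1,2) step.hyps(1)] by blast
  moreover have "(alg_step F P)\<^sup>*\<^sup>* (I, {}) \<sigma>'" using step.prems(1) step.hyps(1) by simp
  ultimately obtain s'' where s'': "exec (While (IsNode 3) body) s' s''" "encodes_set fact_val J (s'' 2)"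
    using step.IH by blast
  have "winnow P (fst \<sigma>) \<noteq> {}" using step.hyps(1) by (auto elim: alg_step.cases)
  then have "is_node (s 3)" using step.prems(2) by (cases \<sigma>) (auto simp: encodes_set_is_node)
  then show ?case using exec_While_step[OF _ s'(1) s''(1)] s''(2) by blast
qed

text \<open>Data complexity appears in the order of quantifiers: commands and polynomial are built
  from a list of the constraints before \<open>I\<close> and \<open>P\<close> are given.\<close>

lemma implementation_exists:
  fixes F :: "('r, 'd) denial set"
  assumes "finite F" "\<forall>dc \<in> F. wf_denial S dc"
  shows "\<exists>init body p. \<forall>I P. finite I \<and> priority F I P \<longrightarrow>
     implements F I P init body \<and> all_runs_within p I P (loop_program init body)"
proof -
  obtain dcs where F: "set dcs = F" using finite_list[OF assms(1)] by blast
  obtain U where U: "poly_bounded U" "\<And>(s :: ('r, 'd) store) I P. input_store I P s \<Longrightarrow>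
     runs init_com s (U (input_size s)) (represents P (I, {}))"
    using runs_init_com by blast
  obtain T where T: "poly_bounded T"
    and T_runs: "\<And>N (s :: ('r, 'd) store) I P \<sigma>. (alg_step F P)\<^sup>*\<^sup>* (I, {}) \<sigma> \<Longrightarrow>
      represents P \<sigma> s \<Longrightarrow> size_bound I P N \<Longrightarrow> winnow P (fst \<sigma>) \<noteq> {} \<Longrightarrow>
      runs (body_com dcs) s (T N) (\<lambda>s'. \<exists>\<sigma>'. alg_step F P \<sigma> \<sigma>' \<and> represents P \<sigma>' s')"
    and T_exec: "\<And>N (s :: ('r, 'd) store) I P \<sigma> \<sigma>'. (alg_step F P)\<^sup>*\<^sup>* (I, {}) \<sigma> \<Longrightarrow>
      represents P \<sigma> s \<Longrightarrow> size_bound I P N \<Longrightarrow> alg_step F P \<sigma> \<sigma>' \<Longrightarrow>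
      \<exists>s'. exec (body_com dcs) s s' \<and> represents P \<sigma>' s'"
    using body_com_correct[of dcs S] assms(2) unfolding F by blast
  let ?init = "init_com :: ('r, 'd) com" and ?body = "body_com dcs"
  \<comment> \<open>Initialization, then at most \<open>card I\<close> iterations, and
    \<open>card I\<close> is at most the input size.\<close>
  let ?V = "\<lambda>N. U N + 1 + (N * (T N + 3) + 2)"
  have "poly_bounded ?V" by (intro poly_bounded_intros U T)
  then obtain p where p: "\<And>n. ?V n \<le> poly p n" unfolding poly_bounded_def by blast
  have "implements F I P ?init ?body \<and> all_runs_within p I P (loop_program ?init ?body)"
    if fin: "finite I" and pr: "priority F I P" for I P
  proof -
    have "finite P" using pr fin finite_subset[of P "I \<times> I"] by (auto simp: priority_def)
    then obtain N where N: "size_bound I P N" using size_bound_exists fin by blast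
    have body_runs: "runs ?body s (T M) (\<lambda>s'. \<exists>\<sigma>'. alg_step F P \<sigma> \<sigma>' \<and> represents P \<sigma>' s')"
      if "(alg_step F P)\<^sup>*\<^sup>* (I, {}) \<sigma>" "represents P \<sigma> s" "winnow P (fst \<sigma>) \<noteq> {}"
        "size_bound I P M" for \<sigma> s M
      using T_runs that by blast
    have body_exec: "\<exists>s'. exec ?body s s' \<and> represents P \<sigma>' s'"
      if "(alg_step F P)\<^sup>*\<^sup>* (I, {}) \<sigma>" "represents P \<sigma> s" "alg_step F P \<sigma> \<sigma>'" for \<sigma> \<sigma>' s
      using T_exec N that by blast
    have loop: "runs (loop_program ?init ?body) s (?V (input_size s))
        (\<lambda>s'. \<exists>J. alg_returns F I P J \<and> encodes_set fact_val J (s' 2))"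
      if s: "input_store I P s" for s
      unfolding loop_program_def
    proof (rule runs_Seq_frame[OF U(2)[OF s]])
      fix s' assume "represents P (I, {}) s'"
      then have "runs (While (IsNode 3) ?body) s'
          (card I * (T (input_size s) + 3) + 2)
          (\<lambda>s'. \<exists>J. alg_returns F I P J \<and> encodes_set fact_val J (s' 2))"
        using body_runs[OF _ _ _ size_bound_input[OF s]]
        by (intro runs_main_loop[where \<sigma> = "(I, {})"]) (simp_all add: fin)
      moreover have "card I \<le> input_size s"
      proof -
        obtain xs where "distinct xs" "set xs = I" "s 0 = list_val (map fact_val xs)"
          using s by (auto simp: input_store_def encodes_set_def)
        then show ?thesis
          using list_val_bounds(1)[of fact_val xs "val_size (s 0)"] distinct_card[of xs]
          by (simp add: input_size_def)
      qed
      ultimately show "runs (While (IsNode 3) ?body) s'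
          (input_size s * (T (input_size s) + 3) + 2)
          (\<lambda>s'. \<exists>J. alg_returns F I P J \<and> encodes_set fact_val J (s' 2))"
        by (elim runs_mono) (simp add: mult_le_mono1)
    qed
    then have "all_runs_within p I P (loop_program ?init ?body)"
      unfolding all_runs_within_def runs_def using p
      by (metis order_trans surj_pair)
    moreover have "implements F I P ?init ?body"
      unfolding implements_def
    proof (intro conjI allI impI)
      fix s s' :: "('r, 'd) store" assume "input_store I P s \<and> exec ?init s s'"
      then show "represents P (I, {}) s'" using runs_execD[OF U(2)] by blast
    next
      fix \<sigma> and s s' :: "('r, 'd) store"
      assume "(alg_step F P)\<^sup>*\<^sup>* (I, {}) \<sigma> \<and> winnow P (fst \<sigma>) \<noteq> {} \<and> represents P \<sigma> s"
        and "exec ?body s s'"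
      then show "\<exists>\<sigma>'. alg_step F P \<sigma> \<sigma>' \<and> represents P \<sigma>' s'"
        using runs_execD[OF body_runs[OF _ _ _ N]] by blast
    next
      fix \<sigma> \<sigma>' and s :: "('r, 'd) store"
      assume "(alg_step F P)\<^sup>*\<^sup>* (I, {}) \<sigma> \<and> winnow P (fst \<sigma>) \<noteq> {} \<and> represents P \<sigma> s"
        and "alg_step F P \<sigma> \<sigma>'"
      then show "\<exists>s'. exec ?body s s' \<and> represents P \<sigma>' s'" using body_exec by blast
    next
      fix s s' :: "('r, 'd) store"
      assume "input_store I P s" "exec (loop_program ?init ?body) s s'"
      then show "\<exists>J. alg_returns F I P J \<and> encodes_set fact_val J (s' 2)"
        using runs_execD[OF loop] by blast
    next
      fix J and s :: "('r, 'd) store" assume s: "input_store I P s" and "alg_returns F I P J"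
      then obtain Io where run: "(alg_step F P)\<^sup>*\<^sup>* (I, {}) (Io, J)" "winnow P Io = {}"
        unfolding alg_returns_def by blast
      obtain s1 where s1: "exec ?init s s1" "represents P (I, {}) s1"
        using runs_exec[OF U(2)[OF s]] by blast
      have "\<exists>s2. exec (While (IsNode 3) ?body) s1 s2 \<and> encodes_set fact_val J (s2 2)"
        by (rule exec_main_loop[OF _ run rtranclp.rtrancl_refl s1(2)]) (rule body_exec)
      then show "\<exists>s'. exec (loop_program ?init ?body) s s' \<and> encodes_set fact_val J (s' 2)"
        unfolding loop_program_def using exec_Seq[OF s1(1)] by blast
    qed
    ultimately show ?thesis by blast
  qed
  then show ?thesis by blast
qed

theorem theorem4:
  fixes S :: "'r schema"
    and F :: "('r, 'd) denial set"
  assumes "infinite (UNIV :: 'd set)"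
    and "wf_schema S"
    and "finite F"
    and "\<forall>dc \<in> F. wf_denial S dc"
  shows "(\<forall>I P. db_instance S I \<and> priority F I P \<longrightarrow>
            (\<nexists>run. run 0 = (I, {}) \<and> (\<forall>n. alg_step F P (run n) (run (Suc n)))) \<and>
            (\<forall>J. alg_returns F I P J \<longrightarrow> repair F I J \<and> completion_optimal F I P J) \<and>
            (\<forall>J. repair F I J \<and> completion_optimal F I P J \<longrightarrow> alg_returns F I P J)) \<and>
         (\<exists>init body p. \<forall>I P. db_instance S I \<and> priority F I P \<longrightarrow>
            implements F I P init body \<and> all_runs_within p I P (loop_program init body))"
proof (intro conjI)
  \<comment> \<open>Every constraint has at least one atom, so the empty set violates none.\<close>
  have empty: "consistent F {}"
    using assms(4) by (intro consistent_empty) (auto simp: wf_denial_def)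
  have fin: "finite I" if "db_instance S I" for I :: "('r, 'd) fact set"
    using that by (simp add: db_instance_def)
  show "\<forall>I P. db_instance S I \<and> priority F I P \<longrightarrow>
      (\<nexists>run. run 0 = (I, {}) \<and> (\<forall>n. alg_step F P (run n) (run (Suc n)))) \<and>
      (\<forall>J. alg_returns F I P J \<longrightarrow> repair F I J \<and> completion_optimal F I P J) \<and>
      (\<forall>J. repair F I J \<and> completion_optimal F I P J \<longrightarrow> alg_returns F I P J)"
  proof (intro allI impI)
    fix I P assume "db_instance S I \<and> priority F I P"
    then have I: "finite I" "priority F I P" using fin by auto
    show "(\<nexists>run. run 0 = (I, {}) \<and> (\<forall>n. alg_step F P (run n) (run (Suc n)))) \<and>
      (\<forall>J. alg_returns F I P J \<longrightarrow> repair F I J \<and> completion_optimal F I P J) \<and>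
      (\<forall>J. repair F I J \<and> completion_optimal F I P J \<longrightarrow> alg_returns F I P J)"
      by (intro conjI alg_terminates[OF I(1)])
         (simp_all add: alg_returns_iff_completion_optimal[OF I empty])
  qed
  show "\<exists>init body p. \<forall>I P. db_instance S I \<and> priority F I P \<longrightarrow>
      implements F I P init body \<and> all_runs_within p I P (loop_program init body)"
  proof -
    obtain init body p where "\<forall>I P. finite I \<and> priority F I P \<longrightarrow>
        implements F I P init body \<and> all_runs_within p I P (loop_program init body)"
      using implementation_exists[OF assms(3,4)] by blast
    then show ?thesis by (intro exI[of _ init] exI[of _ body] exI[of _ p]) (simp add: fin)
  qed
qed

end
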